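(* Let $m,n\in\mathbb N_0$, let $q\in\mathbb C$ with $0<|q|<1$, and let $\alpha,a,b\in\mathbb C\setminus\{0\}$ be such that $(-q\alpha t;q)_\infty\neq 0$ and $(qt/\alpha;q)_\infty\ne 0$ for every $t\in\{a,b\}$. Then the $q^{-1}$-Al-Salam--Chihara polynomials $\mathsf Q_n[z;a,b|q]$ satisfy $$\sum_{k=-\infty}^\infty (1+q^{2k}\alpha^2)\,\mathsf Q_m[q^k\alpha;a,b|q]\,\mathsf Q_n[q^k\alpha;a,b|q]\,\frac{(\frac{\alpha}{a},\frac{\alpha}{b};q)_k}{(-q\alpha a,-q\alpha b;q)_k}\,q^{2\binom k2}(q\alpha^2 ab)^k$$ $$=\frac{(q,-\alpha^2,-\frac{q}{\alpha^2},-qab;q)_\infty}{(-q\alpha a,-q\alpha b,\frac{qa}{\alpha},\frac{qb}{\alpha};q)_\infty}\,q^{-2\binom n2}\left(\frac{ab}{q}\right)^n\Big(q,-\frac1{ab};q\Big)_n\,\delta_{m,n}.$$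
   Context: Notation: $\mathbb N_0=\{0,1,2,\dots\}$. For $n\in\mathbb N_0$, $(y;q)_n=\prod_{j=0}^{n-1}(1-yq^j)$, $(y;q)_\infty=\prod_{j\ge0}(1-yq^j)$; for negative indices, $(y;q)_{-j}=1/(yq^{-j};q)_j$ (so $1/(y;q)_{-j}=(yq^{-j};q)_j$), $j\in\mathbb N$. Products: $(y_1,\dots,y_r;q)_k=\prod_i(y_i;q)_k$, also for $k=\infty$. $\binom k2=k(k-1)/2$ for all $k\in\mathbb Z$. $\delta_{m,n}$ is the Kronecker delta. The $q^{-1}$-Al-Salam--Chihara polynomials are polynomials of degree $n$ in $x=\frac12(z-z^{-1})$, defined by $\mathsf Q_n[z;a,b|q]=i^{-n}Q_n[iz;ia,ib|q^{-1}]$, where $Q_n$ is the Al-Salam--Chihara polynomial in standard normalization, written as a function of $w$ with argument $\frac12(w+w^{-1})$. Explicitly, $$\mathsf Q_n[z;a,b|q]=q^{-\binom n2}(-b)^n\sum_{k=0}^n\frac{(q^{-n},\frac za,-\frac1{az};q)_k}{(q;q)_k}(-1)^kq^{-\binom k2}\Big(\frac{q^na}{b}\Big)^k\Big(-\frac{q^k}{ab};q\Big)_{n-k}.$$ *)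

theory Defs
  imports "HOL-Analysis.Analysis"
begin

definition qpoch :: "complex \<Rightarrow> complex \<Rightarrow> nat \<Rightarrow> complex" where
  "qpoch y q n = (\<Prod>j<n. 1 - y * q ^ j)"

definition qpoch_inf :: "complex \<Rightarrow> complex \<Rightarrow> complex" where
  "qpoch_inf y q = (\<Prod>j. 1 - y * q ^ j)"

definition qpoch_int :: "complex \<Rightarrow> complex \<Rightarrow> int \<Rightarrow> complex" where
  "qpoch_int y q k =
     (if k \<ge> 0 then qpoch y q (nat k) else 1 / qpoch (y * q powi k) q (nat (- k)))"

text \<open>The division is exact, also for negative \<open>k\<close>.\<close>

definition binom2 :: "int \<Rightarrow> int" where
  "binom2 k = k * (k - 1) div 2"

text \<open>
  The Al-Salam--Chihara polynomial \<open>Q\<^sub>n(x; a, b | p)\<close> at \<open>x = (w + 1/w)/2\<close>, in the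
  normalization \<open>(ab;p)\<^sub>n / a\<^sup>n\<close> times the \<open>3\<phi>2\<close> series with upper parameters
  \<open>p\<^sup>-\<^sup>n, a w, a / w\<close>, lower parameters \<open>a b, 0\<close>, base \<open>p\<close> and argument \<open>p\<close>.
  The quotient \<open>(ab;p)\<^sub>n / (ab;p)\<^sub>k\<close> is written as \<open>(ab p\<^sup>k;p)\<^sub>n\<^sub>-\<^sub>k\<close>, so that the
  polynomial is also defined when \<open>(ab;p)\<^sub>k\<close> vanishes.
\<close>

definition al_salam_chihara ::
  "nat \<Rightarrow> complex \<Rightarrow> complex \<Rightarrow> complex \<Rightarrow> complex \<Rightarrow> complex" where
  "al_salam_chihara n w a b p =
     (\<Sum>k\<le>n. qpoch (p powi (- int n)) p k * qpoch (a * w) p k * qpoch (a / w) p k / qpoch p p k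
            * qpoch (a * b * p ^ k) p (n - k) * p ^ k) / a ^ n"

definition qinv_al_salam_chihara ::
  "nat \<Rightarrow> complex \<Rightarrow> complex \<Rightarrow> complex \<Rightarrow> complex \<Rightarrow> complex" where
  "qinv_al_salam_chihara n z a b q =
     \<i> powi (- int n) * al_salam_chihara n (\<i> * z) (\<i> * a) (\<i> * b) (inverse q)"

lemma two_binom2: "2 * binom2 k = k * (k - 1)"
proof -
  have "even (k * (k - 1))" by simp
  then show ?thesis unfolding binom2_def by simp
qed

lemma qpoch_inverse_base:
  assumes "y \<noteq> 0" "q \<noteq> 0"
  shows "qpoch y (inverse q) k = qpoch (inverse y) q k * (- y) ^ k * q powi (- binom2 (int k))"
proof (induction k)
  case 0
  then show ?case by (simp add: qpoch_def binom2_def)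
next
  case (Suc k)
  have b: "binom2 (int (Suc k)) = binom2 (int k) + int k"
    using two_binom2[of "int (Suc k)"] two_binom2[of "int k"] by (simp add: algebra_simps)
  have p: "q powi (- binom2 (int (Suc k))) = q powi (- binom2 (int k)) * inverse q ^ k"
  proof -
    have "- binom2 (int (Suc k)) = - binom2 (int k) - int k" using b by linarith
    then show ?thesis using assms
      by (simp only: power_int_diff divide_inverse power_inverse power_int_of_nat simp_thms)
  qed
  have f: "1 - y * inverse q ^ k = (1 - inverse y * q ^ k) * (- y) * inverse q ^ k"
    using assms by (simp add: field_simps)
  have "qpoch y (inverse q) (Suc k) = qpoch y (inverse q) k * (1 - y * inverse q ^ k)"
    by (simp add: qpoch_def)
  also have "\<dots> = (qpoch (inverse y) q k * (1 - inverse y * q ^ k)) * ((- y) ^ k * (- y))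
      * (q powi (- binom2 (int k)) * inverse q ^ k)"
    unfolding Suc.IH f by (simp only: mult_ac)
  also have "\<dots> = qpoch (inverse y) q (Suc k) * (- y) ^ Suc k * q powi (- binom2 (int (Suc k)))"
    unfolding p by (simp add: qpoch_def mult_ac)
  finally show ?case .
qed

lemma qinv_al_salam_chihara_explicit:
  assumes "q \<noteq> 0" "a \<noteq> 0" "b \<noteq> 0" "z \<noteq> 0"
  shows "qinv_al_salam_chihara n z a b q =
    q powi (- binom2 (int n)) * (- b) ^ n *
      (\<Sum>k\<le>n. qpoch (q powi (- int n)) q k * qpoch (z / a) q k * qpoch (- 1 / (a * z)) q k / qpoch q q k
         * (- 1) ^ k * q powi (- binom2 (int k)) * (q ^ n * a / b) ^ k
         * qpoch (- (q ^ k / (a * b))) q (n - k))"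
proof -
  let ?p = "inverse q"
  let ?B = "\<lambda>k. q powi (- binom2 (int k))"
  have pre: "\<i> powi (- int n) / (\<i> * a) ^ n = (- 1) ^ n / a ^ n"
  proof -
    have "\<i> ^ n * \<i> ^ n = (- 1) ^ n" by (simp flip: power_mult_distrib)
    then have "\<i> powi (- int n) / (\<i> * a) ^ n = 1 / ((- 1) ^ n * a ^ n)"
      by (simp add: power_int_minus power_mult_distrib divide_inverse flip: mult.assoc inverse_mult_distrib)
    also have "\<dots> = (- 1) ^ n / a ^ n"
      by (cases "even n") simp_all
    finally show ?thesis .
  qed
  have trm: "(- 1) ^ n / a ^ n * (qpoch (?p powi (- int n)) ?p k * qpoch (\<i> * a * (\<i> * z)) ?p k
            * qpoch (\<i> * a / (\<i> * z)) ?p k / qpoch ?p ?p k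
            * qpoch (\<i> * a * (\<i> * b) * ?p ^ k) ?p (n - k) * ?p ^ k) =
      q powi (- binom2 (int n)) * (- b) ^ n *
        (qpoch (q powi (- int n)) q k * qpoch (z / a) q k * qpoch (- 1 / (a * z)) q k / qpoch q q k
         * (- 1) ^ k * ?B k * (q ^ n * a / b) ^ k * qpoch (- (q ^ k / (a * b))) q (n - k))"
    if "k \<le> n" for k
  proof -
    define j where "j = n - k"
    have n: "n = k + j" using that j_def by simp
    have e1: "qpoch (?p powi (- int n)) ?p k = qpoch (q powi (- int n)) q k * (- (q ^ n)) ^ k * ?B k"
      using assms qpoch_inverse_base[of "q ^ n" q k]
      by (simp add: power_int_minus power_inverse)
    have e2: "qpoch (\<i> * a * (\<i> * z)) ?p k = qpoch (- 1 / (a * z)) q k * (a * z) ^ k * ?B k"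
    proof -
      have "\<i> * a * (\<i> * z) = (\<i> * \<i>) * (a * z)" by (simp only: mult_ac)
      then have "\<i> * a * (\<i> * z) = - (a * z)" by simp
      then show ?thesis using assms qpoch_inverse_base[of "- (a * z)" q k]
        by (simp add: divide_inverse)
    qed
    have e3: "qpoch (\<i> * a / (\<i> * z)) ?p k = qpoch (z / a) q k * (- (a / z)) ^ k * ?B k"
    proof -
      have "\<i> * a / (\<i> * z) = a / z" by (rule mult_divide_mult_cancel_left) simp
      then show ?thesis using assms qpoch_inverse_base[of "a / z" q k] by simp
    qed
    have e4: "qpoch ?p ?p k = qpoch q q k * (- ?p) ^ k * ?B k"
      using assms qpoch_inverse_base[of "?p" q k] by simp
    have e5: "qpoch (\<i> * a * (\<i> * b) * ?p ^ k) ?p j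
        = qpoch (- (q ^ k / (a * b))) q j * (a * b * ?p ^ k) ^ j * ?B j"
    proof -
      have "\<i> * a * (\<i> * b) * ?p ^ k = (\<i> * \<i>) * (a * b * ?p ^ k)" by (simp only: mult_ac)
      then have "\<i> * a * (\<i> * b) * ?p ^ k = - (a * b * ?p ^ k)" by simp
      then show ?thesis using assms qpoch_inverse_base[of "- (a * b * ?p ^ k)" q j]
        by (simp add: divide_inverse power_inverse mult_ac)
    qed
    have B0: "?B i \<noteq> 0" for i using assms by simp
    have bn: "binom2 (int n) = binom2 (int k) + binom2 (int j) + int k * int j"
      using two_binom2[of "int n"] two_binom2[of "int k"] two_binom2[of "int j"]
      by (simp add: n algebra_simps)
    have Bn: "?B n = ?B k * ?B j * (?p ^ k) ^ j"
    proof -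
      have "- binom2 (int n) = - binom2 (int k) + - binom2 (int j) - int (k * j)" by (simp add: bn)
      then show ?thesis using assms
        by (simp only: power_int_diff power_int_add divide_inverse power_inverse power_int_of_nat
            power_mult simp_thms)
    qed
    have pw: "(- 1) ^ n / a ^ n * ((- (q ^ n)) ^ k * (a * z) ^ k * (- (a / z)) ^ k / (- ?p) ^ k
         * (a * b * ?p ^ k) ^ j * ?p ^ k)
        = (?p ^ k) ^ j * (- b) ^ n * ((- 1) ^ k * (q ^ n * a / b) ^ k)"
    proof -
      have s: "(- (q ^ n)) ^ k * (a * z) ^ k * (- (a / z)) ^ k / (- ?p) ^ k * ?p ^ k
          = (- 1) ^ k * (q ^ n * a * a) ^ k"
      proof -
        have "(- (q ^ n)) ^ k * (a * z) ^ k * (- (a / z)) ^ k / (- ?p) ^ k * ?p ^ k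
            = ((- (q ^ n)) * (a * z) * (- (a / z)) / (- ?p) * ?p) ^ k"
          by (simp only: power_mult_distrib power_divide)
        also have "(- (q ^ n)) * (a * z) * (- (a / z)) / (- ?p) * ?p = (- 1) * (q ^ n * a * a)"
          using assms by (simp add: field_simps)
        finally show ?thesis by (simp only: power_mult_distrib)
      qed
      have t: "(- 1) ^ n / a ^ n * ((q ^ n * a * a) ^ k * (a * b * ?p ^ k) ^ j)
          = (?p ^ k) ^ j * (- b) ^ n * (q ^ n * a / b) ^ k"
      proof -
        have "(- b) ^ n = (- 1) ^ n * b ^ k * b ^ j"
          by (subst power_minus) (simp add: n power_add mult_ac)
        moreover have "a ^ n = a ^ k * a ^ j" by (simp add: n power_add)
        ultimately show ?thesis using assms
          by (simp add: power_mult_distrib power_divide)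
      qed
      have "(- 1) ^ n / a ^ n * ((- (q ^ n)) ^ k * (a * z) ^ k * (- (a / z)) ^ k / (- ?p) ^ k
         * (a * b * ?p ^ k) ^ j * ?p ^ k)
        = (- 1) ^ n / a ^ n * (((- (q ^ n)) ^ k * (a * z) ^ k * (- (a / z)) ^ k / (- ?p) ^ k * ?p ^ k)
         * (a * b * ?p ^ k) ^ j)"
        by (simp only: mult_ac)
      also have "\<dots> = (- 1) ^ k * ((- 1) ^ n / a ^ n * ((q ^ n * a * a) ^ k * (a * b * ?p ^ k) ^ j))"
        unfolding s by (simp only: mult_ac)
      finally show ?thesis unfolding t by (simp only: mult_ac)
    qed
    have comb: "c * ((P1 * x1 * B) * (P2 * x2 * B) * (P3 * x3 * B) / (P4 * x4 * B) * (P5 * x5 * Bj) * pk)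
        = (c * (x1 * x2 * x3 / x4 * x5 * pk)) * (P1 * P3 * P2 / P4 * P5 * B * (B * Bj))"
      if "B \<noteq> 0" for c P1 x1 B P2 x2 P3 x3 P4 x4 P5 x5 Bj pk :: complex
      using that by (simp add: divide_inverse mult_ac)
    show ?thesis
      unfolding j_def[symmetric] e1 e2 e3 e4 e5 comb[OF B0] pw Bn by (simp add: mult_ac)
  qed
  have "qinv_al_salam_chihara n z a b q =
     (\<i> powi (- int n) / (\<i> * a) ^ n) * (\<Sum>k\<le>n. qpoch (?p powi (- int n)) ?p k * qpoch (\<i> * a * (\<i> * z)) ?p k
            * qpoch (\<i> * a / (\<i> * z)) ?p k / qpoch ?p ?p k
            * qpoch (\<i> * a * (\<i> * b) * ?p ^ k) ?p (n - k) * ?p ^ k)"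
    by (simp only: qinv_al_salam_chihara_def al_salam_chihara_def times_divide_eq_right times_divide_eq_left)
  also have "\<dots> = q powi (- binom2 (int n)) * (- b) ^ n *
      (\<Sum>k\<le>n. qpoch (q powi (- int n)) q k * qpoch (z / a) q k * qpoch (- 1 / (a * z)) q k / qpoch q q k
         * (- 1) ^ k * ?B k * (q ^ n * a / b) ^ k
         * qpoch (- (q ^ k / (a * b))) q (n - k))"
    unfolding pre sum_distrib_left by (intro sum.cong refl trm) simp
  finally show ?thesis .
qed

end

theory Submission
  imports Defs
begin

text \<open>
  Put \<open>z = q\<^sup>k \<alpha>\<close>.  After multiplication by
  \<open>(- q \<alpha> a, - q \<alpha> b, q a / \<alpha>, q b / \<alpha>; q)\<^sub>\<infinity>\<close> the weight of the orthogonality relation becomes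
  \<open>(1 + z\<^sup>2) w\<^sub>k F(a, z) F(b, z)\<close>, where \<open>w\<^sub>k\<close> is free of \<open>a\<close> and \<open>b\<close> and
  \<open>F(a, z) = (- q z a, q a / z; q)\<^sub>\<infinity>\<close> is entire in \<open>a\<close> (\<open>weight_eq_mass_term\<close>).  In this form
  \<open>a\<close> and \<open>b\<close> can be moved freely, without attention to zeros of denominators.

  \<^emph>\<open>Total mass.\<close>  Let \<open>T(a, b)\<close> be the sum of this weight over \<open>k\<close>.  The difference between the
  summands of \<open>T(a, b)\<close> and \<open>(1 + q a b) T(q a, b)\<close> telescopes (\<open>mass_shift\<close>).  Iterating and
  letting \<open>q\<^sup>n a\<close> tend to \<open>0\<close> gives \<open>T(a, b) = (- q a b; q)\<^sub>\<infinity> T(0, 0)\<close>.  At \<open>a = \<alpha>\<close>,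
  \<open>b = - 1 / \<alpha>\<close> only the term \<open>k = 0\<close> is different from \<open>0\<close>, and this yields
  \<open>T(0, 0) = (q, - \<alpha>\<^sup>2, - q / \<alpha>\<^sup>2; q)\<^sub>\<infinity>\<close>; so Jacobi's triple product, which is what \<open>T(0, 0)\<close>
  amounts to, is a consequence of the dependence on \<open>a\<close> and \<open>b\<close> (\<open>mass_eq\<close>).

  \<^emph>\<open>Orthogonality.\<close>  Let \<open>\<phi>\<^sub>k(a) = (z / a, - 1 / (a z); q)\<^sub>k\<close>, a polynomial of degree \<open>k\<close> in
  \<open>z - 1 / z\<close>.  Up to a constant, \<open>\<phi>\<^sub>k(a) F(a, z)\<close> is \<open>F(a q\<^sup>-\<^sup>k, z)\<close>, so the weighted sum of
  \<open>\<phi>\<^sub>i(a) \<phi>\<^sub>j(b)\<close> is a total mass with shifted parameters (\<open>moment_asc_basis\<close>).  The explicit formula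
  expands the polynomial of degree \<open>n\<close> in the \<open>\<phi>\<^sub>i(a)\<close>; its weighted sum against \<open>\<phi>\<^sub>j(b)\<close> is a
  terminating \<open>q\<close>-series that vanishes for \<open>j < n\<close> and has one surviving term for \<open>j = n\<close>
  (\<open>moment_asc_poly\<close>).  Finally the other polynomial is written in the \<open>\<phi>\<^sub>j(b)\<close>, where only the
  leading coefficient matters (\<open>orthogonality\<close>).
\<close>

section \<open>The $q$-Pochhammer symbols\<close>

lemma qpoch_0 [simp]: "qpoch y q 0 = 1"
  by (simp add: qpoch_def)

lemma qpoch_Suc: "qpoch y q (Suc n) = qpoch y q n * (1 - y * q ^ n)"
  by (simp add: qpoch_def)

lemma qpoch_add: "qpoch y q (m + n) = qpoch y q m * qpoch (y * q ^ m) q n"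
  by (induction n) (simp_all add: qpoch_Suc power_add mult_ac)

lemma qpoch_Suc_left: "qpoch y q (Suc n) = (1 - y) * qpoch (y * q) q n"
  using qpoch_add[of y q 1 n] by (simp add: qpoch_Suc)

lemma qpoch_inf_LIMSEQ:
  assumes "norm q < 1"
  shows "(\<lambda>n. qpoch y q n) \<longlonglongrightarrow> qpoch_inf y q"
proof -
  have "summable (\<lambda>i. norm ((1 - y * q ^ i) - 1))"
    using assms by (simp add: norm_mult norm_power)
  then have "convergent_prod (\<lambda>i. 1 - y * q ^ i)"
    by (intro abs_convergent_prod_imp_convergent_prod summable_imp_abs_convergent_prod)
  from convergent_prod_LIMSEQ[OF this] show ?thesis
    unfolding qpoch_def qpoch_inf_def LIMSEQ_lessThan_iff_atMost .
qed

lemma qpoch_inf_split: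
  assumes "norm q < 1"
  shows "qpoch_inf y q = qpoch y q n * qpoch_inf (y * q ^ n) q"
proof (rule LIMSEQ_unique)
  show "(\<lambda>m. qpoch y q (m + n)) \<longlonglongrightarrow> qpoch_inf y q"
    using qpoch_inf_LIMSEQ[OF assms] by (rule LIMSEQ_ignore_initial_segment)
  have "(\<lambda>m. qpoch y q n * qpoch (y * q ^ n) q m) \<longlonglongrightarrow> qpoch y q n * qpoch_inf (y * q ^ n) q"
    by (intro tendsto_mult tendsto_const qpoch_inf_LIMSEQ assms)
  then show "(\<lambda>m. qpoch y q (m + n)) \<longlonglongrightarrow> qpoch y q n * qpoch_inf (y * q ^ n) q"
    by (simp only: qpoch_add add.commute[of _ n])
qed

lemma qpoch_inf_Suc:
  assumes "norm q < 1"
  shows "qpoch_inf y q = (1 - y) * qpoch_inf (y * q) q"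
  using qpoch_inf_split[OF assms, of y 1] by (simp add: qpoch_Suc)

lemma qpoch_inf_powi_split:
  assumes "norm q < 1" "q \<noteq> 0"
  shows "qpoch_inf (y * q powi k) q
       = qpoch (y * q powi k) q n * qpoch_inf (y * q powi (k + int n)) q"
  using qpoch_inf_split[OF assms(1), of "y * q powi k" n] assms(2)
  by (simp add: power_int_add mult_ac)

lemma qpoch_inf_0 [simp]: "qpoch_inf 0 q = 1"
  by (simp add: qpoch_inf_def)

lemma norm_qpoch_inf_minus_1_le:
  assumes "norm q < 1"
  shows "norm (qpoch_inf y q - 1) \<le> exp (norm y / (1 - norm q)) - 1"
proof -
  have "norm (qpoch y q n - 1) \<le> exp (norm y / (1 - norm q)) - 1" for n
  proof -
    have "norm (qpoch y q n - 1) \<le> (\<Prod>j<n. 1 + norm (- (y * q ^ j))) - 1"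
      using norm_prod_minus1_le_prod_minus1[of "\<lambda>j. - (y * q ^ j)" "{..<n}"]
      by (simp add: qpoch_def)
    also have "(\<Prod>j<n. 1 + norm (- (y * q ^ j))) \<le> (\<Prod>j<n. exp (norm y * norm q ^ j))"
      by (intro prod_mono) (auto simp: norm_mult norm_power intro!: exp_ge_add_one_self add_nonneg_nonneg)
    also have "\<dots> = exp (norm y * (\<Sum>j<n. norm q ^ j))"
      by (simp add: exp_sum sum_distrib_left)
    also have "\<dots> \<le> exp (norm y * (\<Sum>j. norm q ^ j))"
      using assms by (simp add: mult_left_mono sum_le_suminf)
    also have "(\<Sum>j. norm q ^ j) = 1 / (1 - norm q)"
      using assms by (intro suminf_geometric) simp
    finally show ?thesis by simp
  qed
  moreover have "(\<lambda>n. norm (qpoch y q n - 1)) \<longlonglongrightarrow> norm (qpoch_inf y q - 1)"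
    by (intro tendsto_intros qpoch_inf_LIMSEQ assms)
  ultimately show ?thesis
    by (intro LIMSEQ_le_const2) auto
qed

lemma qpoch_inf_tendsto_1:
  assumes "norm q < 1" "(f \<longlongrightarrow> 0) F"
  shows "((\<lambda>x. qpoch_inf (f x) q) \<longlongrightarrow> 1) F"
proof -
  have "((\<lambda>x. exp (norm (f x) / (1 - norm q)) - 1) \<longlongrightarrow> exp (norm (0::complex) / (1 - norm q)) - 1) F"
    using assms(1) by (intro tendsto_intros assms(2)) auto
  then have lim: "((\<lambda>x. exp (norm (f x) / (1 - norm q)) - 1) \<longlongrightarrow> 0) F"
    by simp
  have "((\<lambda>x. qpoch_inf (f x) q - 1) \<longlongrightarrow> 0) F"
    by (rule Lim_null_comparison[OF _ lim]) (intro always_eventually allI norm_qpoch_inf_minus_1_le assms)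
  then show ?thesis
    by (simp add: LIM_zero_iff)
qed

lemma norm_qpoch_inf_le:
  assumes "norm q < 1" "norm y \<le> A"
  shows "norm (qpoch_inf y q) \<le> exp (A / (1 - norm q))"
proof -
  have "norm (qpoch_inf y q) \<le> norm (qpoch_inf y q - 1) + 1"
    using norm_triangle_ineq[of "qpoch_inf y q - 1" 1] by simp
  also have "\<dots> \<le> exp (norm y / (1 - norm q))"
    using norm_qpoch_inf_minus_1_le[OF assms(1), of y] by simp
  also have "\<dots> \<le> exp (A / (1 - norm q))"
    using assms by (simp add: divide_right_mono)
  finally show ?thesis .
qed

lemma norm_qpoch_inf_le_pos:
  assumes "norm q < 1" "norm y \<le> A"
  shows "norm (qpoch_inf (y * q ^ n) q) \<le> exp (A / (1 - norm q))"
proof (rule norm_qpoch_inf_le[OF assms(1)])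
  have "norm (y * q ^ n) \<le> norm y * 1"
    unfolding norm_mult norm_power using assms(1) by (intro mult_left_mono power_le_one) auto
  then show "norm (y * q ^ n) \<le> A" using assms(2) by simp
qed

text \<open>
  Moving the argument outwards by \<open>q\<^sup>-\<^sup>n\<close> adds the factors \<open>1 - y q\<^sup>-\<^sup>i\<close> with \<open>1 \<le> i \<le> n\<close>,
  each of which is at most \<open>(1 + \<bar>y\<bar>) \<bar>q\<bar>\<^sup>-\<^sup>i\<close>.
\<close>

lemma norm_qpoch_inf_le_neg:
  assumes "norm q < 1" "q \<noteq> 0" "norm y \<le> A"
  shows "norm (qpoch_inf (y * q powi (- int n)) q) * norm q ^ (\<Sum>i\<le>n. i)
       \<le> exp (A / (1 - norm q)) * (1 + A) ^ n"
proof (induction n)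
  case 0
  then show ?case using norm_qpoch_inf_le[OF assms(1,3)] by simp
next
  case (Suc n)
  have A: "0 \<le> A" using assms(3) norm_ge_zero order_trans by blast
  have p: "y * q powi (- int (Suc n)) * q = y * q powi (- int n)"
    using assms(2) power_int_add_1[of q "- int (Suc n)"] by simp
  have "norm (1 - y * q powi (- int (Suc n))) * norm q ^ Suc n
      = norm ((1 - y * q powi (- int (Suc n))) * q ^ Suc n)"
    by (simp add: norm_mult norm_power)
  also have "(1 - y * q powi (- int (Suc n))) * q ^ Suc n = q ^ Suc n - y"
    using assms(2) by (simp only: power_int_minus power_int_of_nat) (simp add: field_simps)
  also have "norm \<dots> \<le> norm (q ^ Suc n) + norm y" by (rule norm_triangle_ineq4)
  also have "norm (q ^ Suc n) \<le> 1"
    unfolding norm_power using assms(1) by (intro power_le_one) auto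
  finally have f: "norm (1 - y * q powi (- int (Suc n))) * norm q ^ Suc n \<le> 1 + A"
    using assms(3) by linarith
  have "norm (qpoch_inf (y * q powi (- int (Suc n))) q) * norm q ^ (\<Sum>i\<le>Suc n. i)
      = (norm (qpoch_inf (y * q powi (- int n)) q) * norm q ^ (\<Sum>i\<le>n. i))
        * (norm (1 - y * q powi (- int (Suc n))) * norm q ^ Suc n)"
    by (subst qpoch_inf_Suc[OF assms(1)], subst p) (simp only: norm_mult sum.atMost_Suc power_add mult_ac)
  also have "\<dots> \<le> (exp (A / (1 - norm q)) * (1 + A) ^ n) * (1 + A)"
    using f by (intro mult_mono Suc.IH mult_nonneg_nonneg) (auto simp: A)
  finally show ?case by (simp add: mult_ac)
qed

text \<open>
  In the bilateral sum two of the four infinite products move inwards and two move outwards, whatever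
  the sign of the index.  Together they grow like \<open>\<bar>q\<bar>\<^bsup>- n (n + 1)\<^esup>\<close>.
\<close>

lemma norm_qpoch_inf_four_le:
  assumes "norm q < 1" "q \<noteq> 0" "norm a \<le> A" "norm b \<le> A" "norm c \<le> A" "norm d \<le> A"
  shows "norm (qpoch_inf (a * q ^ n) q * qpoch_inf (b * q ^ n) q
               * (qpoch_inf (c * q powi (- int n)) q * qpoch_inf (d * q powi (- int n)) q))
           * norm q ^ (n * (n + 1))
       \<le> exp (A / (1 - norm q)) ^ 4 * ((1 + A) ^ n) ^ 2"
proof -
  let ?E = "exp (A / (1 - norm q))"
  have A: "0 \<le> A" using assms(3) norm_ge_zero order_trans by blast
  have s: "n * (n + 1) = (\<Sum>i\<le>n. i) + (\<Sum>i\<le>n. i)"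
    by (induction n) auto
  have "norm (qpoch_inf (a * q ^ n) q * qpoch_inf (b * q ^ n) q
               * (qpoch_inf (c * q powi (- int n)) q * qpoch_inf (d * q powi (- int n)) q))
           * norm q ^ (n * (n + 1))
     = (norm (qpoch_inf (a * q ^ n) q) * norm (qpoch_inf (b * q ^ n) q))
       * ((norm (qpoch_inf (c * q powi (- int n)) q) * norm q ^ (\<Sum>i\<le>n. i))
       * (norm (qpoch_inf (d * q powi (- int n)) q) * norm q ^ (\<Sum>i\<le>n. i)))"
    unfolding s power_add norm_mult by (simp only: mult_ac)
  also have "\<dots> \<le> (?E * ?E) * ((?E * (1 + A) ^ n) * (?E * (1 + A) ^ n))"
    using A by (intro mult_mono norm_qpoch_inf_le_pos norm_qpoch_inf_le_neg assms mult_nonneg_nonneg) auto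
  finally show ?thesis by (simp add: power2_eq_square power4_eq_xxxx mult_ac)
qed

text \<open>
  This is the majorant of the bilateral sum: geometric growth in \<open>\<bar>k\<bar>\<close> loses against the
  Gaussian factor \<open>r\<^bsup>k\<^sup>2\<^esup>\<close>.
\<close>

lemma summable_gaussian_bound:
  fixes M r :: real
  assumes "0 \<le> r" "r < 1" "0 \<le> M"
  shows "(\<lambda>k::int. M ^ nat \<bar>k\<bar> * r ^ (nat \<bar>k\<bar> * nat \<bar>k\<bar>)) summable_on UNIV"
proof -
  define g where "g n = M ^ n * r ^ (n * n)" for n :: nat
  have "(\<lambda>n. M * r ^ n) \<longlonglongrightarrow> M * 0"
    by (intro tendsto_intros LIMSEQ_power_zero) (use assms in auto)
  then have "eventually (\<lambda>n. M * r ^ n < 1/2) sequentially"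
    by (intro order_tendstoD) auto
  then have "eventually (\<lambda>n. norm (g n) \<le> (1/2) ^ n) sequentially"
  proof eventually_elim
    case (elim n)
    have "norm (g n) = (M * r ^ n) ^ n"
      using assms by (simp add: g_def power_mult_distrib power_mult)
    also have "\<dots> \<le> (1/2) ^ n"
      using elim assms by (intro power_mono) auto
    finally show ?case .
  qed
  then have "summable g"
    by (rule summable_comparison_test_ev) simp
  moreover have "g n \<ge> 0" for n using assms by (simp add: g_def)
  ultimately have g: "g summable_on UNIV"
    by (intro summable_nonneg_imp_summable_on)
  have "(\<lambda>k::int. g (nat \<bar>k\<bar>)) summable_on (range int)"
    using g by (subst summable_on_reindex) (auto simp: o_def)
  moreover have "(\<lambda>k::int. g (nat \<bar>k\<bar>)) summable_on (range (\<lambda>n. - int n))"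
    using g by (subst summable_on_reindex) (auto simp: o_def inj_on_def)
  ultimately have "(\<lambda>k::int. g (nat \<bar>k\<bar>)) summable_on (range int \<union> range (\<lambda>n. - int n))"
    by (rule summable_on_union)
  also have "range int \<union> range (\<lambda>n. - int n) = UNIV"
  proof (intro equalityI subsetI UNIV_I)
    fix k :: int
    show "k \<in> range int \<union> range (\<lambda>n. - int n)"
      by (cases k rule: int_cases2) auto
  qed
  finally show ?thesis by (simp add: g_def)
qed

lemma qpoch_q_nonzero:
  assumes "norm q < 1"
  shows "qpoch q q n \<noteq> 0"
proof -
  have "q * q ^ j \<noteq> 1" for j
  proof
    assume "q * q ^ j = 1"
    then have "norm q ^ Suc j = 1" by (metis norm_one norm_power power_Suc)
    moreover have "norm q ^ Suc j < 1"
      using power_strict_mono[of "norm q" 1 "Suc j"] assms by simp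
    ultimately show False by simp
  qed
  then show ?thesis by (simp add: qpoch_def)
qed

text \<open>
  The tails \<open>(q\<^sup>N\<^sup>+\<^sup>1;q)\<^sub>\<infinity>\<close> tend to \<open>1\<close>, and the finitely many factors before such a tail are
  different from \<open>0\<close>.
\<close>

lemma qpoch_inf_q_nonzero:
  assumes "norm q < 1"
  shows "qpoch_inf q q \<noteq> 0"
proof -
  obtain N where N: "norm (qpoch_inf (q * q ^ N) q - 1) < 1"
  proof -
    have "(\<lambda>n. q * q ^ n) \<longlonglongrightarrow> q * 0"
      using assms by (intro tendsto_intros LIMSEQ_power_zero)
    then have "(\<lambda>n. qpoch_inf (q * q ^ n) q) \<longlonglongrightarrow> 1"
      by (intro qpoch_inf_tendsto_1 assms) simp
    then have "eventually (\<lambda>n. dist (qpoch_inf (q * q ^ n) q) 1 < 1) sequentially"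
      by (rule tendstoD) simp
    then show ?thesis
      using that by (auto simp: dist_norm eventually_sequentially)
  qed
  then have "qpoch_inf (q * q ^ N) q \<noteq> 0" by auto
  then show ?thesis
    using qpoch_inf_split[OF assms, of q N] qpoch_q_nonzero[OF assms, of N] by simp
qed

lemma qpoch_inf_eq_0:
  assumes "norm q < 1" "q \<noteq> 0"
  shows "qpoch_inf (q powi (- int n)) q = 0"
  using qpoch_inf_powi_split[OF assms, of 1 "- int n" "Suc n"] assms
  by (simp add: qpoch_Suc power_int_minus)

lemma powi_binom2_Suc:
  assumes "q \<noteq> 0"
  shows "q powi binom2 (int (Suc k)) = q powi binom2 (int k) * (q::complex) ^ k"
proof -
  have "binom2 (int (Suc k)) = binom2 (int k) + int k"
    using two_binom2[of "int (Suc k)"] two_binom2[of "int k"] by (simp add: algebra_simps)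
  then show ?thesis using assms by (simp only: power_int_add power_int_of_nat simp_thms)
qed

lemma powi_binom2_add:
  assumes "q \<noteq> 0"
  shows "q powi binom2 (int (i + j)) = q powi binom2 (int i) * q powi binom2 (int j) * (q::complex) ^ (i * j)"
proof -
  have "binom2 (int (i + j)) = binom2 (int i) + binom2 (int j) + int (i * j)"
    using two_binom2[of "int (i + j)"] two_binom2[of "int i"] two_binom2[of "int j"]
    by (simp add: algebra_simps)
  then show ?thesis using assms by (simp only: power_int_add power_int_of_nat simp_thms)
qed

lemma powi_binom2_0 [simp]: "(q::complex) powi binom2 0 = 1"
  by (simp add: binom2_def)

lemma power_square_eq_binom2:
  assumes "q \<noteq> 0"
  shows "(q::complex) ^ (n * n) = (q powi binom2 (int n))\<^sup>2 * q ^ n"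
proof (induction n)
  case (Suc n)
  have "Suc n * Suc n = n * n + n + n + 1" by simp
  then have "q ^ (Suc n * Suc n) = q ^ (n * n) * q ^ n * q ^ n * q"
    by (simp only: power_add power_one_right)
  then show ?case
    unfolding powi_binom2_Suc[OF assms] Suc.IH by (simp add: power2_eq_square mult_ac)
qed simp

lemma qpoch_inf_shift_down:
  assumes "norm q < 1" "q \<noteq> 0" "p \<noteq> 0"
  shows "qpoch_inf (- q * p / q ^ N) q
       = p ^ N / q powi binom2 (int N) * qpoch (- 1 / p) q N * qpoch_inf (- q * p) q"
proof (induction N)
  case (Suc N)
  have "qpoch_inf (- q * p / q ^ Suc N) q = (1 + p / q ^ N) * qpoch_inf (- q * p / q ^ N) q"
    by (subst qpoch_inf_Suc[OF assms(1)]) (use assms in \<open>simp add: mult_ac\<close>)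
  also have "1 + p / q ^ N = p / q ^ N * (1 - (- 1 / p) * q ^ N)"
    using assms by (simp add: field_simps)
  finally show ?case
    unfolding Suc.IH powi_binom2_Suc[OF assms(2)] qpoch_Suc by (simp add: mult_ac)
qed simp

lemma qpoch_powi_neg:
  assumes "q \<noteq> 0"
  shows "qpoch (q powi (- int n)) q n = (- 1) ^ n * qpoch q q n / (q powi binom2 (int n) * q ^ n)"
proof (induction n)
  case (Suc n)
  have p: "q powi (- int (Suc n)) * q = q powi (- int n)"
    using assms power_int_add_1[of q "- int (Suc n)"] by simp
  have "1 - q powi (- int (Suc n)) = - (1 - q * q ^ n) / q ^ Suc n"
    using assms by (simp only: power_int_minus power_int_of_nat) (simp add: field_simps)
  moreover have "qpoch (q powi (- int (Suc n))) q (Suc n)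
      = (1 - q powi (- int (Suc n))) * qpoch (q powi (- int n)) q n"
    by (simp only: qpoch_Suc_left p)
  ultimately show ?case
    using assms by (simp only: Suc.IH powi_binom2_Suc[OF assms] qpoch_Suc[of q]) (simp add: field_simps)
qed simp

text \<open>
  Both \<open>1 / (y;q)\<^sub>k\<close> and the quotient of infinite products lose the factor \<open>1 - y q\<^sup>k\<close> when \<open>k\<close> grows
  by one.  For \<open>k < 0\<close> a pole of \<open>(y;q)\<^sub>k\<close> is represented by \<open>1 / 0 = 0\<close>, and the reciprocal
  \<open>1 / 0 = 0\<close> of this is again the correct value.
\<close>

lemma qpoch_int_eq_quotient:
  assumes "norm q < 1" "q \<noteq> 0" "qpoch_inf y q \<noteq> 0"
  shows "1 / qpoch_int y q k = qpoch_inf (y * q powi k) q / qpoch_inf y q"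
proof (cases "k \<ge> 0")
  case True
  then obtain n where k: "k = int n" using nonneg_int_cases by blast
  show ?thesis
    using qpoch_inf_split[OF assms(1), of y n] assms(3) by (simp add: k qpoch_int_def)
next
  case False
  then obtain n where k: "k = - int n" by (metis int_cases2 of_nat_0_le_iff)
  show ?thesis
    using qpoch_inf_powi_split[OF assms(1,2), of y "- int n" n] assms(3) False by (simp add: k qpoch_int_def)
qed

text \<open>
  The right-hand side satisfies the recurrence \<open>g (k + 1) = (1 - y q\<^sup>k) g k\<close> of \<open>(y;q)\<^sub>k\<close>, because
  \<open>- y q\<^sup>k\<close> times the new factor \<open>1 - q\<^sup>-\<^sup>k / y\<close> of the infinite product is \<open>1 - y q\<^sup>k\<close>.
\<close>

lemma qpoch_int_eq_reversed:
  assumes "norm q < 1" "q \<noteq> 0" "y \<noteq> 0" "qpoch_inf (q / y) q \<noteq> 0"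
  shows "qpoch_int y q k
       = (- y) powi k * q powi binom2 k * qpoch_inf (q / (y * q powi k)) q / qpoch_inf (q / y) q"
proof -
  define g where "g k = (- y) powi k * q powi binom2 k * qpoch_inf (q / (y * q powi k)) q" for k
  have step: "g (k + 1) = (1 - y * q powi k) * g k" for k
  proof -
    have "binom2 (k + 1) = binom2 k + k"
      using two_binom2[of "k + 1"] two_binom2[of k] by (simp add: algebra_simps)
    moreover have "qpoch_inf (q / (y * q powi (k + 1))) q
        = (1 - 1 / (y * q powi k)) * qpoch_inf (q / (y * q powi k)) q"
      by (subst qpoch_inf_Suc[OF assms(1)]) (use assms in \<open>simp add: power_int_add\<close>)
    ultimately have "g (k + 1) = ((- y) * q powi k * (1 - 1 / (y * q powi k))) * g k"
      using assms by (simp add: g_def power_int_add mult_ac)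
    also have "(- y) * q powi k * (1 - 1 / (y * q powi k)) = 1 - y * q powi k"
      using assms by (simp add: field_simps)
    finally show ?thesis .
  qed
  have steps: "g (k + int n) = qpoch (y * q powi k) q n * g k" for k n
  proof (induction n)
    case (Suc n)
    then show ?case
      using step[of "k + int n"] assms(2) by (simp add: qpoch_Suc power_int_add add_ac mult_ac)
  qed simp
  have g0: "g 0 = qpoch_inf (q / y) q" by (simp add: g_def binom2_def)
  have "qpoch_int y q k = g k / g 0"
  proof (cases "k \<ge> 0")
    case True
    then obtain n where k: "k = int n" using nonneg_int_cases by blast
    show ?thesis using steps[of 0 n] assms(4) by (simp add: k qpoch_int_def g0)
  next
    case False
    then obtain n where k: "k = - int n" by (metis int_cases2 of_nat_0_le_iff)
    have "g 0 = qpoch (y * q powi k) q n * g k" using steps[of k n] by (simp add: k)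
    moreover have "qpoch_int y q k = 1 / qpoch (y * q powi k) q n"
      using False by (simp add: k qpoch_int_def)
    ultimately show ?thesis using g0 assms(4) by auto
  qed
  then show ?thesis unfolding g0 by (simp add: g_def)
qed

section \<open>The total mass\<close>

text \<open>
  The generating function of the \<open>q\<^sup>-\<^sup>1\<close>-Hermite polynomials in \<open>(z - 1 / z) / 2\<close>, up to the
  normalization of the variable \<open>a\<close>.
\<close>

definition hermite_gen :: "complex \<Rightarrow> complex \<Rightarrow> complex \<Rightarrow> complex" where
  "hermite_gen q a z = qpoch_inf (- q * z * a) q * qpoch_inf (q * a / z) q"

text \<open>
  At \<open>z = q\<^sup>k \<alpha>\<close>, the numbers \<open>theta_weight q \<alpha> k\<close> and \<open>z\<^sup>2 theta_weight q \<alpha> k\<close> are the terms with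
  index \<open>2 k\<close> and \<open>2 k + 1\<close> of the theta series with general term \<open>q\<^bsup>n (n - 1) / 2\<^esup> \<alpha>\<^bsup>2 n\<^esup>\<close>.
\<close>

definition theta_weight :: "complex \<Rightarrow> complex \<Rightarrow> int \<Rightarrow> complex" where
  "theta_weight q \<alpha> k = q powi (2 * k * k) * (\<alpha> ^ 4 / q) powi k"

lemma norm_hermite_gen_pair_le:
  assumes "norm q < 1" "q \<noteq> 0" "\<alpha> \<noteq> 0" "norm a \<le> A" "norm b \<le> A"
  defines "B \<equiv> A * (norm (q * \<alpha>) + norm (q / \<alpha>))"
  shows "norm (hermite_gen q a (q powi k * \<alpha>) * hermite_gen q b (q powi k * \<alpha>))
           * norm q ^ (nat \<bar>k\<bar> * (nat \<bar>k\<bar> + 1))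
       \<le> exp (B / (1 - norm q)) ^ 4 * ((1 + B) ^ nat \<bar>k\<bar>) ^ 2"
proof -
  have A: "0 \<le> A" using assms(4) norm_ge_zero order_trans by blast
  have B1: "norm (- q * \<alpha> * t) \<le> B" if "norm t \<le> A" for t
  proof -
    have "norm (- q * \<alpha> * t) = norm t * norm (q * \<alpha>)" by (simp add: norm_mult)
    also have "\<dots> \<le> A * (norm (q * \<alpha>) + norm (q / \<alpha>))"
      using that A by (intro mult_mono) auto
    finally show ?thesis by (simp add: B_def)
  qed
  have B2: "norm (q * t / \<alpha>) \<le> B" if "norm t \<le> A" for t
  proof -
    have "norm (q * t / \<alpha>) = norm t * norm (q / \<alpha>)" by (simp add: norm_mult norm_divide)
    also have "\<dots> \<le> A * (norm (q * \<alpha>) + norm (q / \<alpha>))"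
      using that A by (intro mult_mono) auto
    finally show ?thesis by (simp add: B_def)
  qed
  have g: "hermite_gen q t (q powi k * \<alpha>)
      = qpoch_inf (- q * \<alpha> * t * q powi k) q * qpoch_inf (q * t / \<alpha> * q powi (- k)) q" for t
    using assms(2) by (simp add: hermite_gen_def power_int_minus field_simps)
  show ?thesis
  proof (cases "k \<ge> 0")
    case True
    then obtain n where k: "k = int n" using nonneg_int_cases by blast
    show ?thesis
      using norm_qpoch_inf_four_le[OF assms(1,2) B1[OF assms(4)] B1[OF assms(5)] B2[OF assms(4)] B2[OF assms(5)], of n]
      unfolding g unfolding k by (simp add: mult_ac)
  next
    case False
    then obtain n where k: "k = - int n" by (metis int_cases2 of_nat_0_le_iff)
    show ?thesis
      using norm_qpoch_inf_four_le[OF assms(1,2) B2[OF assms(4)] B2[OF assms(5)] B1[OF assms(4)] B1[OF assms(5)], of n]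
      unfolding g unfolding k by (simp add: mult_ac)
  qed
qed

text \<open>
  The majorant is uniform in \<open>a\<close> and \<open>b\<close>, so that it also serves for the passage to the limit in
  the parameters.  The Gaussian factor \<open>q\<^bsup>2 k\<^sup>2\<^esup>\<close> outweighs the growth of the generating functions,
  and \<open>\<bar>q\<bar>\<^bsup>k\<^sup>2\<^esup>\<close> is left over.
\<close>

lemma theta_weight_domination:
  assumes "norm q < 1" "q \<noteq> 0" "\<alpha> \<noteq> 0" "0 \<le> A"
  obtains g where "g summable_on UNIV"
    "\<And>a b k. norm a \<le> A \<Longrightarrow> norm b \<le> A \<Longrightarrow>
      norm ((q powi k * \<alpha>) ^ i * theta_weight q \<alpha> k
            * (hermite_gen q a (q powi k * \<alpha>) * hermite_gen q b (q powi k * \<alpha>))) \<le> g k"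
proof -
  define r where "r = norm q"
  define B where "B = A * (norm (q * \<alpha>) + norm (q / \<alpha>))"
  define E where "E = exp (B / (1 - norm q)) ^ 4"
  define t where "t = norm (q ^ i * \<alpha> ^ 4 / q)"
  define M where "M = (t + 1 / t) * (1 + B) ^ 2 / r"
  define g where "g k = norm \<alpha> ^ i * E * (M ^ nat \<bar>k\<bar> * r ^ (nat \<bar>k\<bar> * nat \<bar>k\<bar>))" for k :: int
  have r: "0 < r" "r < 1" using assms by (auto simp: r_def)
  have t: "0 < t" using assms by (simp add: t_def)
  have B: "0 \<le> B" using assms by (simp add: B_def)
  have M: "0 \<le> M" using t B r by (simp add: M_def)
  show ?thesis
  proof (rule that[of g])
    show "g summable_on UNIV"
      unfolding g_def by (intro summable_on_cmult_right summable_gaussian_bound) (use r M in auto)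
  next
    fix a b :: complex and k :: int assume ab: "norm a \<le> A" "norm b \<le> A"
    define N where "N = nat \<bar>k\<bar>"
    define G where "G = norm (hermite_gen q a (q powi k * \<alpha>) * hermite_gen q b (q powi k * \<alpha>))"
    have "2 * k * k = int (2 * N * N)" by (simp add: N_def)
    then have rk: "norm (q powi (2 * k * k)) = r ^ (2 * N * N)"
      by (simp add: norm_power r_def del: of_nat_mult)
    have tk: "t powi k \<le> (t + 1 / t) ^ N"
    proof (cases "k \<ge> 0")
      case True
      then have "t powi k = t ^ N" by (simp add: power_int_def N_def)
      also have "\<dots> \<le> (t + 1 / t) ^ N" using t by (intro power_mono) auto
      finally show ?thesis .
    next
      case False
      then have "t powi k = (1 / t) ^ N" by (simp add: power_int_def N_def divide_inverse)
      also have "\<dots> \<le> (t + 1 / t) ^ N" using t by (intro power_mono) auto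
      finally show ?thesis .
    qed
    have "(q powi k) ^ i = (q ^ i) powi k"
      by (metis power_int_mult power_int_of_nat mult.commute)
    then have "(q powi k * \<alpha>) ^ i * theta_weight q \<alpha> k = \<alpha> ^ i * q powi (2 * k * k) * (q ^ i * \<alpha> ^ 4 / q) powi k"
      by (simp add: theta_weight_def power_mult_distrib power_int_mult_distrib power_int_divide_distrib mult_ac)
    then have w: "norm ((q powi k * \<alpha>) ^ i * theta_weight q \<alpha> k) = norm \<alpha> ^ i * r ^ (2 * N * N) * t powi k"
      by (simp only: norm_mult rk) (simp add: norm_power norm_power_int t_def)
    have "r ^ N * (norm ((q powi k * \<alpha>) ^ i * theta_weight q \<alpha> k) * G)
        = norm \<alpha> ^ i * r ^ (N * N) * t powi k * (G * r ^ (N * (N + 1)))"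
      unfolding w by (simp add: power_add algebra_simps mult_2_right)
    also have "\<dots> \<le> norm \<alpha> ^ i * r ^ (N * N) * (t + 1 / t) ^ N * (E * ((1 + B) ^ N) ^ 2)"
      unfolding G_def E_def r_def N_def B_def
      by (intro mult_mono mult_left_mono norm_hermite_gen_pair_le assms ab)
         (use t r tk in \<open>auto simp: N_def\<close>)
    also have "\<dots> = r ^ N * g k"
      using r by (simp add: g_def M_def N_def power_mult_distrib power_divide power2_eq_square)
    finally show "norm ((q powi k * \<alpha>) ^ i * theta_weight q \<alpha> k
            * (hermite_gen q a (q powi k * \<alpha>) * hermite_gen q b (q powi k * \<alpha>))) \<le> g k"
      using r by (simp add: G_def norm_mult)
  qed
qed

definition mass_term :: "complex \<Rightarrow> complex \<Rightarrow> complex \<Rightarrow> complex \<Rightarrow> int \<Rightarrow> complex" where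
  "mass_term q \<alpha> a b k = (1 + (q powi k * \<alpha>)\<^sup>2) * theta_weight q \<alpha> k
     * (hermite_gen q a (q powi k * \<alpha>) * hermite_gen q b (q powi k * \<alpha>))"

definition mass :: "complex \<Rightarrow> complex \<Rightarrow> complex \<Rightarrow> complex \<Rightarrow> complex" where
  "mass q \<alpha> a b = (\<Sum>\<^sub>\<infinity>k. mass_term q \<alpha> a b k)"

lemma hermite_gen_0 [simp]: "hermite_gen q 0 z = 1"
  by (simp add: hermite_gen_def)

lemma hermite_gen_shift_parameter:
  assumes "norm q < 1"
  shows "hermite_gen q a z = (1 + q * a * z) * (1 - q * a / z) * hermite_gen q (q * a) z"
  unfolding hermite_gen_def
  by (subst qpoch_inf_Suc[OF assms, of "- q * z * a"], subst qpoch_inf_Suc[OF assms, of "q * a / z"])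
     (simp add: mult_ac)

lemma hermite_gen_shift_argument:
  assumes "norm q < 1" "q \<noteq> 0" "z \<noteq> 0"
  shows "(1 - q * a / z) * hermite_gen q a (z / q) = (1 + z * a) * hermite_gen q a z"
proof -
  have 1: "qpoch_inf (q * a / z) q = (1 - q * a / z) * qpoch_inf (q * a / (z / q)) q"
    by (subst qpoch_inf_Suc[OF assms(1)]) (simp add: mult_ac)
  have 2: "qpoch_inf (- q * (z / q) * a) q = (1 + z * a) * qpoch_inf (- q * z * a) q"
    by (subst qpoch_inf_Suc[OF assms(1)]) (use assms in \<open>simp add: mult_ac\<close>)
  show ?thesis unfolding hermite_gen_def 1 2 by (simp only: mult_ac)
qed

lemma theta_weight_minus_1:
  assumes "q \<noteq> 0" "\<alpha> \<noteq> 0"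
  shows "theta_weight q \<alpha> (k - 1) = theta_weight q \<alpha> k * q ^ 3 / (q powi k * \<alpha>) ^ 4"
proof -
  have p4: "q powi (4 * k) = (q powi k) ^ 4"
    by (metis power_int_mult power_int_numeral mult.commute)
  have e: "2 * (k - 1) * (k - 1) = 2 * k * k - 4 * k + 2" by (simp add: algebra_simps)
  have "q powi (2 * (k - 1) * (k - 1)) = q powi (2 * k * k) / (q powi k) ^ 4 * q ^ 2"
    unfolding e using assms by (simp add: power_int_add power_int_diff p4)
  moreover have "(\<alpha> ^ 4 / q) powi (k - 1) = (\<alpha> ^ 4 / q) powi k / (\<alpha> ^ 4 / q)"
    using assms by (simp add: power_int_diff)
  ultimately show ?thesis
    using assms by (simp add: theta_weight_def power_mult_distrib power2_eq_square power3_eq_cube)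
qed

context
  fixes q \<alpha> :: complex
  assumes q: "norm q < 1" "q \<noteq> 0" and \<alpha>: "\<alpha> \<noteq> 0"
begin

lemma z_nonzero: "q powi k * \<alpha> \<noteq> 0"
  using q \<alpha> by simp

lemma theta_weight_summable:
  "(\<lambda>k. (q powi k * \<alpha>) ^ i * theta_weight q \<alpha> k
        * (hermite_gen q a (q powi k * \<alpha>) * hermite_gen q b (q powi k * \<alpha>))) summable_on UNIV"
proof -
  obtain g where g: "g summable_on UNIV"
    "\<And>a' b' k. norm a' \<le> max (norm a) (norm b) \<Longrightarrow> norm b' \<le> max (norm a) (norm b) \<Longrightarrow>
      norm ((q powi k * \<alpha>) ^ i * theta_weight q \<alpha> k
            * (hermite_gen q a' (q powi k * \<alpha>) * hermite_gen q b' (q powi k * \<alpha>))) \<le> g k"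
    using theta_weight_domination[OF q \<alpha>, of "max (norm a) (norm b)" i] by (auto simp: le_max_iff_disj)
  show ?thesis
    by (rule abs_summable_summable, rule Infinite_Sum.abs_summable_on_comparison_test'[OF g(1)]) (auto intro!: g(2))
qed

lemma mass_term_expand:
  "mass_term q \<alpha> a b k =
     (q powi k * \<alpha>) ^ 0 * theta_weight q \<alpha> k
        * (hermite_gen q a (q powi k * \<alpha>) * hermite_gen q b (q powi k * \<alpha>))
   + (q powi k * \<alpha>) ^ 2 * theta_weight q \<alpha> k
        * (hermite_gen q a (q powi k * \<alpha>) * hermite_gen q b (q powi k * \<alpha>))"
  by (simp add: mass_term_def algebra_simps)

lemma mass_term_has_sum: "(mass_term q \<alpha> a b has_sum mass q \<alpha> a b) UNIV"
proof -
  have "mass_term q \<alpha> a b summable_on UNIV"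
    unfolding mass_term_expand[abs_def] by (intro summable_on_add theta_weight_summable)
  then show ?thesis
    unfolding mass_def by (rule has_sum_infsum)
qed

lemma mass_commute: "mass q \<alpha> a b = mass q \<alpha> b a"
  by (simp add: mass_def mass_term_def mult.commute)

text \<open>
  With \<open>c = q a\<close> one has \<open>F(a, z) = (1 + c z) (1 - c / z) F(c, z)\<close>, so the summand of
  \<open>T(a, b) - (1 + q a b) T(c, b)\<close> is \<open>c (1 + z\<^sup>2) (z - 1 / z - c - b) w\<^sub>k F(c, z) F(b, z)\<close>.
  This is \<open>c\<close> times a difference \<open>R k - R (k - 1)\<close>, because passing from \<open>z\<close> to \<open>z / q\<close>
  changes \<open>(1 - c / z) F(c, z)\<close> into \<open>(1 + c z) F(c, z)\<close>, and likewise for \<open>b\<close>.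
\<close>

lemma mass_shift: "mass q \<alpha> a b = (1 + q * a * b) * mass q \<alpha> (q * a) b"
proof -
  define c where "c = q * a"
  define z where "z k = q powi k * \<alpha>" for k
  define H where "H k = hermite_gen q c (z k) * hermite_gen q b (z k)" for k
  \<comment> \<open>The antidifference.  The cube is the one power of \<open>z\<close> for which the terms with the product
    \<open>c b\<close> cancel in \<open>R k - R (k - 1)\<close>.\<close>
  define R where "R k = z k ^ 3 * theta_weight q \<alpha> k * (1 - c / z k) * (1 - b / z k) * H k" for k
  have z: "z k \<noteq> 0" for k using z_nonzero by (simp add: z_def)
  have zm: "z (k - 1) = z k / q" for k using q by (simp add: z_def power_int_diff)
  have Rm: "R (k - 1) = theta_weight q \<alpha> k / z k * (1 + z k * c) * (1 + z k * b) * H k" for k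
  proof -
    have "R (k - 1) = (z k / q) ^ 3 * (theta_weight q \<alpha> k * q ^ 3 / z k ^ 4)
        * ((1 - q * c / z k) * hermite_gen q c (z k / q)) * ((1 - q * b / z k) * hermite_gen q b (z k / q))"
      using theta_weight_minus_1[OF q(2) \<alpha>, of k, folded z_def] by (simp add: R_def H_def zm mult_ac)
    also have "\<dots> = (z k / q) ^ 3 * (theta_weight q \<alpha> k * q ^ 3 / z k ^ 4)
        * ((1 + z k * c) * hermite_gen q c (z k)) * ((1 + z k * b) * hermite_gen q b (z k))"
      by (simp only: hermite_gen_shift_argument[OF q z])
    also have "(z k / q) ^ 3 * (theta_weight q \<alpha> k * q ^ 3 / z k ^ 4) = theta_weight q \<alpha> k / z k"
      using z[of k] q(2) by (simp add: field_simps power3_eq_cube power4_eq_xxxx)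
    finally show ?thesis by (simp add: H_def mult_ac)
  qed
  have "R summable_on UNIV"
  proof -
    have "R = (\<lambda>k. z k ^ 3 * theta_weight q \<alpha> k * H k + (- (c + b)) * (z k ^ 2 * theta_weight q \<alpha> k * H k)
        + c * b * (z k ^ 1 * theta_weight q \<alpha> k * H k))"
    proof
      fix k
      have "z k ^ 3 * (1 - c / z k) * (1 - b / z k) = z k ^ 3 - (c + b) * z k ^ 2 + c * b * z k"
        using z[of k] by (simp add: field_simps power2_eq_square power3_eq_cube)
      moreover have "R k = (z k ^ 3 * (1 - c / z k) * (1 - b / z k)) * theta_weight q \<alpha> k * H k"
        by (simp only: R_def mult_ac)
      ultimately have "R k = (z k ^ 3 - (c + b) * z k ^ 2 + c * b * z k) * theta_weight q \<alpha> k * H k"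
        by (simp only:)
      then show "R k = z k ^ 3 * theta_weight q \<alpha> k * H k + (- (c + b)) * (z k ^ 2 * theta_weight q \<alpha> k * H k)
        + c * b * (z k ^ 1 * theta_weight q \<alpha> k * H k)"
        by (simp add: algebra_simps)
    qed
    then show ?thesis
      unfolding H_def z_def
      by (simp only:) (intro summable_on_add summable_on_cmult_right theta_weight_summable)
  qed
  then have R: "(R has_sum infsum R UNIV) UNIV" by (rule has_sum_infsum)
  then have R': "((\<lambda>k. R (k - 1)) has_sum infsum R UNIV) UNIV"
    by (subst has_sum_reindex_bij_witness[of UNIV "\<lambda>k. k + 1" "\<lambda>k. k - 1" UNIV R]) auto
  have diff: "mass_term q \<alpha> a b k = (1 + q * a * b) * mass_term q \<alpha> c b k + c * (R k - R (k - 1))" for k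
  proof -
    have poly: "(1 + w\<^sup>2) * ((1 + c * w) * (1 - c / w))
        = (1 + c * b) * (1 + w\<^sup>2) + c * (w ^ 3 * (1 - c / w) * (1 - b / w) - 1 / w * (1 + w * c) * (1 + w * b))"
      if "w \<noteq> 0" for w
      using that by (simp add: field_simps power2_eq_square power3_eq_cube)
    define X where "X = z k ^ 3 * (1 - c / z k) * (1 - b / z k)"
    define Y where "Y = 1 / z k * (1 + z k * c) * (1 + z k * b)"
    have "mass_term q \<alpha> a b k = ((1 + (z k)\<^sup>2) * ((1 + c * z k) * (1 - c / z k))) * theta_weight q \<alpha> k * H k"
      unfolding mass_term_def z_def[symmetric] H_def
      by (subst hermite_gen_shift_parameter[OF q(1), of a]) (simp add: c_def mult_ac)
    also have "(1 + (z k)\<^sup>2) * ((1 + c * z k) * (1 - c / z k)) = (1 + c * b) * (1 + (z k)\<^sup>2) + c * (X - Y)"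
      unfolding X_def Y_def by (rule poly[OF z])
    also have "\<dots> * theta_weight q \<alpha> k * H k
        = (1 + c * b) * ((1 + (z k)\<^sup>2) * theta_weight q \<alpha> k * H k)
          + c * (X * theta_weight q \<alpha> k * H k - Y * theta_weight q \<alpha> k * H k)"
      by (simp add: algebra_simps)
    also have "X * theta_weight q \<alpha> k * H k = R k"
      by (simp only: X_def R_def mult_ac)
    also have "Y * theta_weight q \<alpha> k * H k = R (k - 1)"
      by (simp add: Rm Y_def)
    finally show ?thesis
      by (simp only: mass_term_def z_def[symmetric] H_def c_def[symmetric])
  qed
  have "((\<lambda>k. (1 + q * a * b) * mass_term q \<alpha> c b k + c * (R k + - R (k - 1))) has_sum
      ((1 + q * a * b) * mass q \<alpha> c b + c * (infsum R UNIV + - infsum R UNIV))) UNIV"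
    by (intro has_sum_add has_sum_cmult_right mass_term_has_sum R R' has_sum_uminusI)
  then have "(mass_term q \<alpha> a b has_sum ((1 + q * a * b) * mass q \<alpha> c b)) UNIV"
    unfolding diff[abs_def] by simp
  from has_sum_unique[OF mass_term_has_sum this] show ?thesis
    by (simp add: c_def)
qed

lemma mass_shift_power: "mass q \<alpha> a b = qpoch (- q * a * b) q n * mass q \<alpha> (q ^ n * a) b"
proof (induction n)
  case (Suc n)
  then show ?case
    using mass_shift[of "q ^ n * a" b] by (simp add: qpoch_Suc mult_ac)
qed simp

text \<open>
  Each summand is continuous at \<open>a = 0\<close>, and the sums converge uniformly along the sequence \<open>q\<^sup>n a\<close>,
  so the limit may be taken term by term.
\<close>

lemma mass_shift_limit: "(\<lambda>n. mass q \<alpha> (q ^ n * a) b) \<longlonglongrightarrow> mass q \<alpha> 0 b"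
proof -
  define A where "A = max (norm a) (norm b)"
  have A: "0 \<le> A" by (simp add: A_def le_max_iff_disj)
  define X where "X i k a b = (q powi k * \<alpha>) ^ i * theta_weight q \<alpha> k
            * (hermite_gen q a (q powi k * \<alpha>) * hermite_gen q b (q powi k * \<alpha>))" for i :: nat and k a b
  obtain g0 where g0: "g0 summable_on UNIV"
    "\<And>a b k. norm a \<le> A \<Longrightarrow> norm b \<le> A \<Longrightarrow> norm (X 0 k a b) \<le> g0 k"
    using theta_weight_domination[OF q \<alpha> A, of 0] unfolding X_def by blast
  obtain g2 where g2: "g2 summable_on UNIV"
    "\<And>a b k. norm a \<le> A \<Longrightarrow> norm b \<le> A \<Longrightarrow> norm (X 2 k a b) \<le> g2 k"
    using theta_weight_domination[OF q \<alpha> A, of 2] unfolding X_def by blast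
  have qa: "norm (q ^ n * a) \<le> A" for n
  proof -
    have "norm (q ^ n * a) \<le> 1 * norm a"
      unfolding norm_mult norm_power using q by (intro mult_right_mono power_le_one) auto
    then show ?thesis by (simp add: A_def)
  qed
  have b: "norm b \<le> A" by (simp add: A_def)
  have unif: "uniform_limit UNIV (\<lambda>X n. \<Sum>k\<in>X. mass_term q \<alpha> (q ^ n * a) b k)
          (\<lambda>n. mass q \<alpha> (q ^ n * a) b) (finite_subsets_at_top UNIV)"
  proof (rule Weierstrass_m_test_general')
    show "(\<lambda>k. g0 k + g2 k) summable_on UNIV"
      by (intro summable_on_add g0 g2)
    show "norm (mass_term q \<alpha> (q ^ n * a) b k) \<le> g0 k + g2 k" for k n
      unfolding mass_term_expand X_def[symmetric]
      by (rule norm_triangle_le) (intro add_mono g0 g2 qa b)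
  qed (rule mass_term_has_sum)
  have total: "((\<lambda>X. \<Sum>k\<in>X. mass_term q \<alpha> 0 b k) \<longlongrightarrow> mass q \<alpha> 0 b) (finite_subsets_at_top UNIV)"
    using mass_term_has_sum unfolding has_sum_def .
  have pointwise: "(\<lambda>n. \<Sum>k\<in>X. mass_term q \<alpha> (q ^ n * a) b k) \<longlonglongrightarrow> (\<Sum>k\<in>X. mass_term q \<alpha> 0 b k)" for X
  proof (rule tendsto_sum)
    fix k
    have qn: "(\<lambda>n. q ^ n) \<longlonglongrightarrow> 0"
      using q by (intro LIMSEQ_power_zero)
    have "(\<lambda>n. - q * (q powi k * \<alpha>) * (q ^ n * a)) \<longlonglongrightarrow> - q * (q powi k * \<alpha>) * (0 * a)"
      by (intro tendsto_intros qn)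
    then have 1: "(\<lambda>n. qpoch_inf (- q * (q powi k * \<alpha>) * (q ^ n * a)) q) \<longlonglongrightarrow> 1"
      by (intro qpoch_inf_tendsto_1 q) simp
    have "(\<lambda>n. q * (q ^ n * a) / (q powi k * \<alpha>)) \<longlonglongrightarrow> q * (0 * a) / (q powi k * \<alpha>)"
      by (intro tendsto_intros qn z_nonzero)
    then have 2: "(\<lambda>n. qpoch_inf (q * (q ^ n * a) / (q powi k * \<alpha>)) q) \<longlonglongrightarrow> 1"
      by (intro qpoch_inf_tendsto_1 q) simp
    have "(\<lambda>n. hermite_gen q (q ^ n * a) (q powi k * \<alpha>)) \<longlonglongrightarrow> 1"
      using tendsto_mult[OF 1 2] unfolding hermite_gen_def by simp
    then have "(\<lambda>n. hermite_gen q (q ^ n * a) (q powi k * \<alpha>)) \<longlonglongrightarrow> hermite_gen q 0 (q powi k * \<alpha>)"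
      by simp
    then show "(\<lambda>n. mass_term q \<alpha> (q ^ n * a) b k) \<longlonglongrightarrow> mass_term q \<alpha> 0 b k"
      unfolding mass_term_def by (intro tendsto_intros)
  qed
  show ?thesis
    by (rule swap_uniform_limit'[OF always_eventually total unif]) (auto intro: pointwise)
qed

lemma mass_eq_times_mass_0: "mass q \<alpha> a b = qpoch_inf (- q * a * b) q * mass q \<alpha> 0 b"
proof (rule LIMSEQ_unique)
  show "(\<lambda>n. mass q \<alpha> a b) \<longlonglongrightarrow> mass q \<alpha> a b" by simp
  have "(\<lambda>n. qpoch (- q * a * b) q n * mass q \<alpha> (q ^ n * a) b) \<longlonglongrightarrow> qpoch_inf (- q * a * b) q * mass q \<alpha> 0 b"
    by (intro tendsto_mult mass_shift_limit qpoch_inf_LIMSEQ q)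
  then show "(\<lambda>n. mass q \<alpha> a b) \<longlonglongrightarrow> qpoch_inf (- q * a * b) q * mass q \<alpha> 0 b"
    by (simp only: mass_shift_power[symmetric])
qed

lemma mass_eq_times_mass_0_0: "mass q \<alpha> a b = qpoch_inf (- q * a * b) q * mass q \<alpha> 0 0"
  using mass_eq_times_mass_0[of b 0] mass_commute[of 0 b] by (subst mass_eq_times_mass_0) simp

text \<open>
  For \<open>a = \<alpha>\<close> and \<open>b = - 1 / \<alpha>\<close> the factors \<open>(q\<^sup>1\<^sup>-\<^sup>k;q)\<^sub>\<infinity>\<close> and \<open>(q\<^sup>1\<^sup>+\<^sup>k;q)\<^sub>\<infinity>\<close> of the
  summand leave only the term with \<open>k = 0\<close>.  Hence the theta sum \<open>mass q \<alpha> 0 0\<close>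
  (Jacobi's triple product) comes out of the dependence on \<open>a\<close> and \<open>b\<close>.
\<close>

lemma mass_0_0_times:
  "qpoch_inf q q * mass q \<alpha> 0 0
     = qpoch_inf q q * (qpoch_inf q q * qpoch_inf (- \<alpha>\<^sup>2) q * qpoch_inf (- q / \<alpha>\<^sup>2) q)"
proof -
  have zero: "mass_term q \<alpha> \<alpha> (- 1 / \<alpha>) k = 0" if "k \<noteq> 0" for k
  proof (cases "k > 0")
    case True
    then have "q * \<alpha> / (q powi k * \<alpha>) = q powi (- int (nat (k - 1)))"
      using q \<alpha> by (simp add: power_int_diff)
    then have "hermite_gen q \<alpha> (q powi k * \<alpha>) = 0"
      by (simp only: hermite_gen_def qpoch_inf_eq_0[OF q] mult_zero_right)
    then show ?thesis by (simp add: mass_term_def)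
  next
    case False
    with that have "- q * (q powi k * \<alpha>) * (- 1 / \<alpha>) = q powi (- int (nat (- k - 1)))"
      using q \<alpha> by (simp add: power_int_add)
    then have "hermite_gen q (- 1 / \<alpha>) (q powi k * \<alpha>) = 0"
      by (simp only: hermite_gen_def qpoch_inf_eq_0[OF q] mult_zero_left)
    then show ?thesis by (simp add: mass_term_def)
  qed
  have "(mass_term q \<alpha> \<alpha> (- 1 / \<alpha>) has_sum mass_term q \<alpha> \<alpha> (- 1 / \<alpha>) 0) UNIV"
    by (rule has_sum_finite_neutralI[of "{0}"]) (use zero in auto)
  then have "mass q \<alpha> \<alpha> (- 1 / \<alpha>) = mass_term q \<alpha> \<alpha> (- 1 / \<alpha>) 0"
    using has_sum_unique mass_term_has_sum by blast
  also have "\<dots> = (1 + \<alpha>\<^sup>2) * (qpoch_inf (- \<alpha>\<^sup>2 * q) q * qpoch_inf q q * (qpoch_inf q q * qpoch_inf (- q / \<alpha>\<^sup>2) q))"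
    using \<alpha> by (simp add: mass_term_def theta_weight_def hermite_gen_def power2_eq_square mult_ac)
  also have "\<dots> = qpoch_inf q q * (qpoch_inf q q * qpoch_inf (- \<alpha>\<^sup>2) q * qpoch_inf (- q / \<alpha>\<^sup>2) q)"
    by (subst (3) qpoch_inf_Suc[OF q(1)]) simp
  also have "mass q \<alpha> \<alpha> (- 1 / \<alpha>) = qpoch_inf q q * mass q \<alpha> 0 0"
    using \<alpha> by (subst mass_eq_times_mass_0_0) simp
  finally show ?thesis .
qed

end

lemma mass_eq:
  assumes "norm q < 1" "q \<noteq> 0" "\<alpha> \<noteq> 0"
  shows "mass q \<alpha> a b
       = qpoch_inf q q * qpoch_inf (- \<alpha>\<^sup>2) q * qpoch_inf (- q / \<alpha>\<^sup>2) q * qpoch_inf (- q * a * b) q"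
  using mass_0_0_times[OF assms] mass_eq_times_mass_0_0[OF assms, of a b] qpoch_inf_q_nonzero[OF assms(1)]
  by simp

text \<open>
  The denominators \<open>(- q \<alpha> t;q)\<^sub>k\<close> turn into \<open>(- q z t;q)\<^sub>\<infinity>\<close> and the numerators \<open>(\<alpha> / t;q)\<^sub>k\<close> into
  \<open>(q t / z;q)\<^sub>\<infinity>\<close>; the powers of \<open>- \<alpha> / t\<close> that the latter leave behind remove \<open>a\<close> and \<open>b\<close> from
  \<open>(q \<alpha>\<^sup>2 a b)\<^sup>k\<close>.
\<close>

lemma weight_eq_mass_term:
  assumes "norm q < 1" "q \<noteq> 0" "\<alpha> \<noteq> 0" "a \<noteq> 0" "b \<noteq> 0"
    and "\<And>t. t \<in> {a, b} \<Longrightarrow> qpoch_inf (- q * \<alpha> * t) q \<noteq> 0 \<and> qpoch_inf (q * t / \<alpha>) q \<noteq> 0"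
  shows "(1 + q powi (2 * k) * \<alpha>\<^sup>2) * (qpoch_int (\<alpha> / a) q k * qpoch_int (\<alpha> / b) q k)
            / (qpoch_int (- q * \<alpha> * a) q k * qpoch_int (- q * \<alpha> * b) q k)
            * q powi (2 * binom2 k) * (q * \<alpha>\<^sup>2 * a * b) powi k
       = mass_term q \<alpha> a b k / (qpoch_inf (- q * \<alpha> * a) q * qpoch_inf (- q * \<alpha> * b) q
                * qpoch_inf (q * a / \<alpha>) q * qpoch_inf (q * b / \<alpha>) q)"
proof -
  have num: "qpoch_int (\<alpha> / t) q k = (- (\<alpha> / t)) powi k * q powi binom2 k
      * qpoch_inf (q * t / (q powi k * \<alpha>)) q / qpoch_inf (q * t / \<alpha>) q" if "t \<in> {a, b}" for t
    using qpoch_int_eq_reversed[OF assms(1,2), of "\<alpha> / t" k] assms(3-5) assms(6)[OF that] that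
    by (auto simp: mult_ac)
  have den: "1 / qpoch_int (- q * \<alpha> * t) q k
      = qpoch_inf (- q * (q powi k * \<alpha>) * t) q / qpoch_inf (- q * \<alpha> * t) q" if "t \<in> {a, b}" for t
    using qpoch_int_eq_quotient[OF assms(1,2), of "- q * \<alpha> * t" k] assms(6)[OF that] by (simp add: mult_ac)
  have "q powi (2 * k) = (q powi k)\<^sup>2"
    by (metis power_int_mult power_int_numeral mult.commute)
  then have z: "q powi (2 * k) * \<alpha>\<^sup>2 = (q powi k * \<alpha>)\<^sup>2"
    by (simp add: power_mult_distrib)
  have regroup: "A * E * (B * E) * D * C = E * E * D * (A * B * C)" for A B C D E :: complex
    by (simp only: mult_ac)
  have w: "(- (\<alpha> / a)) powi k * q powi binom2 k * ((- (\<alpha> / b)) powi k * q powi binom2 k)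
      * q powi (2 * binom2 k) * (q * \<alpha>\<^sup>2 * a * b) powi k = theta_weight q \<alpha> k"
  proof -
    have 1: "(- (\<alpha> / a)) powi k * (- (\<alpha> / b)) powi k * (q * \<alpha>\<^sup>2 * a * b) powi k = (q * \<alpha> ^ 4) powi k"
      using assms by (simp add: power2_eq_square power4_eq_xxxx mult_ac flip: power_int_mult_distrib)
    have 2: "q powi binom2 k * q powi binom2 k * q powi (2 * binom2 k) = q powi (2 * k * k) / (q powi k)\<^sup>2"
    proof -
      have "binom2 k + binom2 k + 2 * binom2 k = 2 * k * k - k - k"
        using two_binom2[of k] by (simp add: algebra_simps)
      then show ?thesis
        using assms(2) by (simp add: power_int_diff power2_eq_square flip: power_int_add)
    qed
    have 3: "(q * \<alpha> ^ 4) powi k / (q powi k)\<^sup>2 = (\<alpha> ^ 4 / q) powi k"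
      using assms by (simp add: power_int_mult_distrib power_int_divide_distrib power2_eq_square)
    show ?thesis
      unfolding theta_weight_def 3[symmetric] by (subst regroup, subst 1, subst 2) simp
  qed
  have "(1 + q powi (2 * k) * \<alpha>\<^sup>2) * (qpoch_int (\<alpha> / a) q k * qpoch_int (\<alpha> / b) q k)
            / (qpoch_int (- q * \<alpha> * a) q k * qpoch_int (- q * \<alpha> * b) q k)
            * q powi (2 * binom2 k) * (q * \<alpha>\<^sup>2 * a * b) powi k
      = (1 + (q powi k * \<alpha>)\<^sup>2) * (qpoch_int (\<alpha> / a) q k * qpoch_int (\<alpha> / b) q k)
            * ((1 / qpoch_int (- q * \<alpha> * a) q k) * (1 / qpoch_int (- q * \<alpha> * b) q k))
            * q powi (2 * binom2 k) * (q * \<alpha>\<^sup>2 * a * b) powi k"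
    unfolding z by simp
  also have "\<dots> = mass_term q \<alpha> a b k / (qpoch_inf (- q * \<alpha> * a) q * qpoch_inf (- q * \<alpha> * b) q
                * qpoch_inf (q * a / \<alpha>) q * qpoch_inf (q * b / \<alpha>) q)"
    unfolding num[OF insertI1] num[OF insertI2[OF singletonI]] den[OF insertI1] den[OF insertI2[OF singletonI]]
      mass_term_def hermite_gen_def w[symmetric]
    by (simp add: divide_inverse mult_ac)
  finally show ?thesis .
qed

section \<open>A terminating $q$-series\<close>

text \<open>
  The coefficients \<open>c n k = (q\<^sup>-\<^sup>n;q)\<^sub>k / (q;q)\<^sub>k\<close> satisfy
  \<open>c (n + 1) (k + 1) = c n (k + 1) - q\<^bsup>- n - 1\<^esup> c n k\<close>, which is multiplication of the right-hand
  side by its new factor \<open>1 - y q\<^bsup>- n - 1\<^esup>\<close>.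
\<close>

lemma q_binomial_theorem:
  assumes "norm q < 1" "q \<noteq> 0"
  shows "(\<Sum>k\<le>n. qpoch (q powi (- int n)) q k / qpoch q q k * y ^ k) = qpoch (y * q powi (- int n)) q n"
proof (induction n)
  case (Suc n)
  define c where "c n k = qpoch (q powi (- int n)) q k / qpoch q q k" for n k
  have p: "q powi (- int (Suc n)) * q = q powi (- int n)"
    using assms power_int_add_1[of q "- int (Suc n)"] by simp
  have rec: "c (Suc n) (Suc k) = c n (Suc k) - q powi (- int (Suc n)) * c n k" for k
  proof -
    have 1: "qpoch (q powi (- int (Suc n))) q (Suc k) = (1 - q powi (- int (Suc n))) * qpoch (q powi (- int n)) q k"
      by (simp only: qpoch_Suc_left p)
    have 2: "qpoch (q powi (- int n)) q (Suc k)
        = qpoch (q powi (- int n)) q k * (1 - q powi (- int (Suc n)) * q * q ^ k)"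
      by (simp only: qpoch_Suc p)
    have nz: "qpoch q q k \<noteq> 0" "1 - q * q ^ k \<noteq> 0"
      using qpoch_q_nonzero[OF assms(1), of "Suc k"] by (auto simp: qpoch_Suc)
    have gen: "(1 - u) * P / (R * (1 - q * x)) = P * (1 - u * q * x) / (R * (1 - q * x)) - u * (P / R)"
      if "R \<noteq> 0" "1 - q * x \<noteq> 0" for u P R x
      using that by (simp add: divide_simps) (simp add: algebra_simps)
    show ?thesis
      unfolding c_def 1 2 qpoch_Suc[of q] by (rule gen[OF nz])
  qed
  have top: "c n (Suc n) = 0"
    using assms by (simp add: c_def qpoch_Suc power_int_minus)
  have "(\<Sum>k\<le>Suc n. c (Suc n) k * y ^ k) = 1 + (\<Sum>k\<le>n. c (Suc n) (Suc k) * y ^ Suc k)"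
    by (subst sum.atMost_Suc_shift) (simp add: c_def)
  also have "\<dots> = (1 + (\<Sum>k\<le>n. c n (Suc k) * y ^ Suc k)) - y * q powi (- int (Suc n)) * (\<Sum>k\<le>n. c n k * y ^ k)"
    unfolding rec by (simp add: sum_subtractf sum_distrib_left algebra_simps)
  also have "1 + (\<Sum>k\<le>n. c n (Suc k) * y ^ Suc k) = (\<Sum>k\<le>Suc n. c n k * y ^ k)"
    by (subst sum.atMost_Suc_shift) (simp add: c_def)
  also have "\<dots> = (\<Sum>k\<le>n. c n k * y ^ k)"
    by (simp add: top)
  also have "\<dots> - y * q powi (- int (Suc n)) * (\<Sum>k\<le>n. c n k * y ^ k)
      = (1 - y * q powi (- int (Suc n))) * (\<Sum>k\<le>n. c n k * y ^ k)"
    by (simp add: algebra_simps)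
  also have "(\<Sum>k\<le>n. c n k * y ^ k) = qpoch (y * q powi (- int n)) q n"
    using Suc.IH by (simp add: c_def)
  also have "(1 - y * q powi (- int (Suc n))) * \<dots> = qpoch (y * q powi (- int (Suc n))) q (Suc n)"
    by (simp only: qpoch_Suc_left mult.assoc p)
  finally show ?case by (simp add: c_def)
qed simp

text \<open>
  A \<open>2\<phi>1\<close> series in disguise: when no \<open>(c;q)\<^sub>k\<close> vanishes, the quotient by \<open>(c;q)\<^sub>j\<close> has upper parameters
  \<open>q\<^sup>-\<^sup>n, c q\<^sup>j\<close>, lower parameter \<open>c\<close> and argument \<open>y\<close>.
\<close>

definition qbinom_sum :: "complex \<Rightarrow> nat \<Rightarrow> complex \<Rightarrow> nat \<Rightarrow> complex \<Rightarrow> complex" where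
  "qbinom_sum q n c j y =
     (\<Sum>k\<le>n. qpoch (q powi (- int n)) q k / qpoch q q k * y ^ k * qpoch (c * q ^ k) q j)"

lemma qbinom_sum_Suc:
  "qbinom_sum q n c (Suc j) y = qbinom_sum q n c j y - c * q ^ j * qbinom_sum q n c j (q * y)"
  unfolding qbinom_sum_def sum_distrib_left sum_subtractf[symmetric]
  by (intro sum.cong refl) (simp add: qpoch_Suc power_mult_distrib algebra_simps)

text \<open>
  For \<open>j = 0\<close> the value \<open>(q\<^bsup>s - n\<^esup>;q)\<^sub>n\<close> contains the factor \<open>1 - q\<^sup>0\<close>.  Each further factor of
  \<open>(c q\<^sup>k;q)\<^sub>j\<close> contributes the same sum with \<open>s\<close> raised by one, and \<open>s\<close> stays in the range of
  vanishing.
\<close>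

lemma qbinom_sum_eq_0:
  assumes "norm q < 1" "q \<noteq> 0" "1 \<le> s" "s + j \<le> n"
  shows "qbinom_sum q n c j (q ^ s) = 0"
  using assms(3,4)
proof (induction j arbitrary: s)
  case 0
  have "q ^ s * q powi (- int n) * q ^ (n - s) = 1"
    using 0 assms by (simp add: power_int_minus field_simps flip: power_add)
  then have "qpoch (q ^ s * q powi (- int n)) q n = 0"
    unfolding qpoch_def using 0 by (intro prod_zero) (auto intro!: bexI[of _ "n - s"])
  then show ?case
    using q_binomial_theorem[OF assms(1,2), where y = "q ^ s" and n = n] by (simp add: qbinom_sum_def)
next
  case (Suc j)
  from Suc.IH[of s] Suc.IH[of "Suc s"] Suc.prems show ?case
    by (simp add: qbinom_sum_Suc)
qed

text \<open>
  Here \<open>s = 0\<close> is just outside the range of vanishing.  The factors of \<open>(c q\<^sup>k;q)\<^sub>j\<close> only add sums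
  with \<open>1 \<le> s\<close>, so the value is the one for \<open>j = 0\<close>.
\<close>

lemma qbinom_sum_1:
  assumes "norm q < 1" "q \<noteq> 0" "j \<le> n"
  shows "qbinom_sum q n c j 1 = qpoch (q powi (- int n)) q n"
  using assms(3)
proof (induction j)
  case 0
  then show ?case
    using q_binomial_theorem[OF assms(1,2), where y = 1 and n = n] by (simp add: qbinom_sum_def)
next
  case (Suc j)
  then show ?case
    using qbinom_sum_eq_0[OF assms(1,2), of 1 j n] by (simp add: qbinom_sum_Suc)
qed

section \<open>Orthogonality\<close>

definition asc_basis :: "complex \<Rightarrow> complex \<Rightarrow> nat \<Rightarrow> complex \<Rightarrow> complex" where
  "asc_basis q a k z = qpoch (z / a) q k * qpoch (- 1 / (a * z)) q k"

lemma asc_basis_0 [simp]: "asc_basis q a 0 z = 1"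
  by (simp add: asc_basis_def)

lemma asc_basis_Suc:
  assumes "a \<noteq> 0" "z \<noteq> 0"
  shows "asc_basis q a (Suc k) z = asc_basis q a k z * (1 - (q ^ k / a)\<^sup>2 - q ^ k / a * (z - 1 / z))"
proof -
  have "(1 - z / a * q ^ k) * (1 - - 1 / (a * z) * q ^ k) = 1 - (q ^ k / a)\<^sup>2 - q ^ k / a * (z - 1 / z)"
    using assms by (simp add: field_simps power2_eq_square)
  then show ?thesis
    by (simp add: asc_basis_def qpoch_Suc mult_ac)
qed

text \<open>
  Each factor pair of \<open>\<phi>\<^sub>k(a)\<close> equals, up to a constant, the factor pair by which \<open>F\<close> grows when
  its parameter is divided by \<open>q\<close>:
  \<open>(1 - z q\<^sup>i / a) (1 + q\<^sup>i / (a z)) = - (q\<^sup>i / a)\<^sup>2 (1 + w z) (1 - w / z)\<close> with \<open>w = a q\<^sup>-\<^sup>i\<close>.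
\<close>

lemma asc_basis_hermite_gen:
  assumes "norm q < 1" "q \<noteq> 0" "a \<noteq> 0" "z \<noteq> 0"
  shows "asc_basis q a k z * hermite_gen q a z
       = (- 1) ^ k * (q powi binom2 (int k))\<^sup>2 / a ^ (2 * k) * hermite_gen q (a / q ^ k) z"
proof (induction k)
  case (Suc k)
  define w where "w = a / q ^ k"
  have w: "w \<noteq> 0" using assms by (simp add: w_def)
  have "hermite_gen q (a / q ^ Suc k) z = (1 + w * z) * (1 - w / z) * hermite_gen q w z"
    by (subst hermite_gen_shift_parameter[OF assms(1)]) (use assms in \<open>simp add: w_def\<close>)
  moreover have "1 - (q ^ k / a)\<^sup>2 - q ^ k / a * (z - 1 / z) = - (q ^ k / a)\<^sup>2 * ((1 + w * z) * (1 - w / z))"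
  proof -
    have e: "q ^ k / a = 1 / w" by (simp add: w_def)
    show ?thesis unfolding e using w assms(4) by (simp add: field_simps power2_eq_square)
  qed
  ultimately have step: "(1 - (q ^ k / a)\<^sup>2 - q ^ k / a * (z - 1 / z)) * hermite_gen q w z
      = - (q ^ k / a)\<^sup>2 * hermite_gen q (a / q ^ Suc k) z"
    by simp
  have "asc_basis q a (Suc k) z * hermite_gen q a z
      = (asc_basis q a k z * hermite_gen q a z) * (1 - (q ^ k / a)\<^sup>2 - q ^ k / a * (z - 1 / z))"
    unfolding asc_basis_Suc[OF assms(3,4)] by (simp only: mult_ac)
  also have "\<dots> = (- 1) ^ k * (q powi binom2 (int k))\<^sup>2 / a ^ (2 * k)
      * ((1 - (q ^ k / a)\<^sup>2 - q ^ k / a * (z - 1 / z)) * hermite_gen q w z)"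
    unfolding Suc.IH w_def by (simp only: mult_ac)
  also have "\<dots> = (- 1) ^ Suc k * (q powi binom2 (int (Suc k)))\<^sup>2 / a ^ (2 * Suc k) * hermite_gen q (a / q ^ Suc k) z"
    unfolding step powi_binom2_Suc[OF assms(2)]
    by (simp add: power_mult_distrib power_divide power2_eq_square mult_ac)
  finally show ?case .
qed simp

text \<open>
  The functions \<open>\<phi>\<^sub>j(b)\<close> with \<open>j \<le> k\<close> span the polynomials of degree at most \<open>k\<close> in \<open>x = z - 1 / z\<close>,
  and the top coefficient \<open>(b / a)\<^sup>k\<close> is the quotient of the leading coefficients of \<open>\<phi>\<^sub>k(a)\<close> and
  \<open>\<phi>\<^sub>k(b)\<close>.  The induction rests on the rule that expresses \<open>x \<phi>\<^sub>j(b)\<close> by \<open>\<phi>\<^sub>j(b)\<close> and \<open>\<phi>\<^sub>j\<^sub>+\<^sub>1(b)\<close>.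
\<close>

lemma asc_basis_change:
  assumes "q \<noteq> 0" "a \<noteq> 0" "b \<noteq> 0"
  obtains e where "\<And>j. j > k \<Longrightarrow> e j = 0" "e k = (b / a) ^ k"
    "\<And>z. z \<noteq> 0 \<Longrightarrow> asc_basis q a k z = (\<Sum>j\<le>k. e j * asc_basis q b j z)"
proof -
  have "\<exists>e. (\<forall>j>k. e j = 0) \<and> e k = (b / a) ^ k \<and>
      (\<forall>z. z \<noteq> 0 \<longrightarrow> asc_basis q a k z = (\<Sum>j\<le>k. e j * asc_basis q b j z))"
  proof (induction k)
    case 0
    show ?case by (rule exI[of _ "\<lambda>j. if j = 0 then 1 else 0"]) simp
  next
    case (Suc k)
    then obtain e where e: "\<And>j. j > k \<Longrightarrow> e j = 0" "e k = (b / a) ^ k"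
      "\<And>z. z \<noteq> 0 \<Longrightarrow> asc_basis q a k z = (\<Sum>j\<le>k. e j * asc_basis q b j z)" by blast
    define A where "A = 1 - (q ^ k / a)\<^sup>2"
    define B where "B = - (q ^ k / a)"
    define U where "U j = (1 - (q ^ j / b)\<^sup>2) / (q ^ j / b)" for j
    define V where "V j = - 1 / (q ^ j / b)" for j
    define e' where "e' j = (A + B * U j) * e j + (case j of 0 \<Rightarrow> 0 | Suc i \<Rightarrow> B * V i * e i)" for j
    have x: "(z - 1 / z) * asc_basis q b j z = U j * asc_basis q b j z + V j * asc_basis q b (Suc j) z"
      if "z \<noteq> 0" for z j
    proof -
      have regroup: "A * C + B * (C * D) = (A + B * D) * C" for A B C D :: complex
        by (simp add: algebra_simps)
      have "U j + V j * (1 - (q ^ j / b)\<^sup>2 - q ^ j / b * (z - 1 / z)) = z - 1 / z"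
      proof -
        have id: "(1 - s\<^sup>2) / s + - 1 / s * (1 - s\<^sup>2 - s * y) = y" if "s \<noteq> 0" for s y :: complex
          using that by (simp add: field_simps)
        show ?thesis unfolding U_def V_def by (rule id) (use assms in simp)
      qed
      then show ?thesis
        unfolding asc_basis_Suc[OF assms(3) that]
        by (metis (mono_tags) regroup)
    qed
    have "asc_basis q a (Suc k) z = (\<Sum>j\<le>Suc k. e' j * asc_basis q b j z)" if z: "z \<noteq> 0" for z
    proof -
      have "asc_basis q a (Suc k) z = (A + B * (z - 1 / z)) * asc_basis q a k z"
        unfolding asc_basis_Suc[OF assms(2) z] by (simp add: A_def B_def mult_ac)
      also have "\<dots> = (\<Sum>j\<le>k. e j * (A * asc_basis q b j z + B * ((z - 1 / z) * asc_basis q b j z)))"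
        unfolding e(3)[OF z] sum_distrib_left by (intro sum.cong refl) (simp add: algebra_simps)
      also have "\<dots> = (\<Sum>j\<le>k. (A + B * U j) * e j * asc_basis q b j z)
          + (\<Sum>j\<le>k. B * V j * e j * asc_basis q b (Suc j) z)"
        unfolding x[OF z] sum.distrib[symmetric] by (intro sum.cong refl) (simp add: algebra_simps)
      also have "(\<Sum>j\<le>k. (A + B * U j) * e j * asc_basis q b j z)
          = (\<Sum>j\<le>Suc k. (A + B * U j) * e j * asc_basis q b j z)"
        by (simp add: e(1))
      also have "(\<Sum>j\<le>k. B * V j * e j * asc_basis q b (Suc j) z)
          = (\<Sum>j\<le>Suc k. (case j of 0 \<Rightarrow> 0 | Suc i \<Rightarrow> B * V i * e i) * asc_basis q b j z)"
        by (subst sum.atMost_Suc_shift) simp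
      finally show ?thesis
        by (simp only: e'_def distrib_right sum.distrib)
    qed
    moreover have "e' j = 0" if "j > Suc k" for j
      using that by (auto simp: e'_def e(1) split: nat.split)
    moreover have "e' (Suc k) = (b / a) ^ Suc k"
      using assms by (simp add: e'_def e B_def V_def)
    ultimately show ?case by blast
  qed
  then show ?thesis using that by blast
qed

definition asc_coeff :: "complex \<Rightarrow> complex \<Rightarrow> complex \<Rightarrow> nat \<Rightarrow> nat \<Rightarrow> complex" where
  "asc_coeff q a b n k = (- b) ^ n / q powi binom2 (int n) *
     (qpoch (q powi (- int n)) q k / qpoch q q k
       * (- 1) ^ k / q powi binom2 (int k) * (q ^ n * a / b) ^ k * qpoch (- 1 / (a * b) * q ^ k) q (n - k))"

lemma qinv_asc_expand:
  assumes "q \<noteq> 0" "a \<noteq> 0" "b \<noteq> 0" "z \<noteq> 0"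
  shows "qinv_al_salam_chihara n z a b q = (\<Sum>k\<le>n. asc_coeff q a b n k * asc_basis q a k z)"
  unfolding qinv_al_salam_chihara_explicit[OF assms] sum_distrib_left
  by (intro sum.cong refl)
     (simp add: asc_coeff_def asc_basis_def power_int_minus divide_inverse mult_ac)

text \<open>
  The polynomial of degree \<open>n\<close> is monic in \<open>z - 1 / z\<close>, so \<open>f n\<close> is the reciprocal of the leading
  coefficient of \<open>\<phi>\<^sub>n(b)\<close>.
\<close>

lemma qinv_asc_expand_swapped:
  assumes "norm q < 1" "q \<noteq> 0" "a \<noteq> 0" "b \<noteq> 0"
  obtains f where "f n = (- b) ^ n / q powi binom2 (int n)"
    "\<And>z. z \<noteq> 0 \<Longrightarrow> qinv_al_salam_chihara n z a b q = (\<Sum>j\<le>n. f j * asc_basis q b j z)"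
proof -
  have "\<exists>e. (\<forall>j>k. e j = 0) \<and> e k = (b / a) ^ k \<and>
      (\<forall>z. z \<noteq> 0 \<longrightarrow> asc_basis q a k z = (\<Sum>j\<le>k. e j * asc_basis q b j z))" for k
    by (rule asc_basis_change[OF assms(2-4), of k]) blast
  then have "\<exists>e. \<forall>k. (\<forall>j>k. e k j = 0) \<and> e k k = (b / a) ^ k \<and>
      (\<forall>z. z \<noteq> 0 \<longrightarrow> asc_basis q a k z = (\<Sum>j\<le>k. e k j * asc_basis q b j z))"
    by (intro choice allI)
  then obtain e where "\<forall>k. (\<forall>j>k. e k j = 0) \<and> e k k = (b / a) ^ k \<and>
      (\<forall>z. z \<noteq> 0 \<longrightarrow> asc_basis q a k z = (\<Sum>j\<le>k. e k j * asc_basis q b j z))" ..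
  then have e: "\<And>k j. j > k \<Longrightarrow> e k j = 0" "\<And>k. e k k = (b / a) ^ k"
      "\<And>k z. z \<noteq> 0 \<Longrightarrow> asc_basis q a k z = (\<Sum>j\<le>k. e k j * asc_basis q b j z)"
    by auto
  define f where "f j = (\<Sum>k\<le>n. asc_coeff q a b n k * e k j)" for j
  show ?thesis
  proof (rule that[of f])
    have "f n = (\<Sum>k\<in>{n}. asc_coeff q a b n k * e k n)"
      unfolding f_def by (rule sum.mono_neutral_right) (auto simp: e(1))
    also have "\<dots> = asc_coeff q a b n n * (b / a) ^ n"
      by (simp add: e(2))
    also have "\<dots> = (- b) ^ n / q powi binom2 (int n)"
    proof -
      have "(q ^ n * a / b) ^ n = (q powi binom2 (int n))\<^sup>2 * q ^ n * (a / b) ^ n"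
        by (simp add: power_mult_distrib power_divide power_square_eq_binom2[OF assms(2)] flip: power_mult)
      moreover have "(a / b) ^ n * (b / a) ^ n = 1"
        using assms by (simp flip: power_mult_distrib)
      moreover have "(- 1) ^ n * (- 1) ^ n = (1::complex)"
        by (simp flip: power_mult_distrib)
      ultimately show ?thesis
        unfolding asc_coeff_def qpoch_powi_neg[OF assms(2)]
        using assms qpoch_q_nonzero[OF assms(1), of n]
        by (simp add: power2_eq_square field_simps)
    qed
    finally show "f n = (- b) ^ n / q powi binom2 (int n)" .
  next
    fix z :: complex assume z: "z \<noteq> 0"
    have "asc_basis q a k z = (\<Sum>j\<le>n. e k j * asc_basis q b j z)" if "k \<le> n" for k
      unfolding e(3)[OF z] using that by (intro sum.mono_neutral_left) (auto simp: e(1))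
    then have "qinv_al_salam_chihara n z a b q
        = (\<Sum>k\<le>n. \<Sum>j\<le>n. asc_coeff q a b n k * e k j * asc_basis q b j z)"
      unfolding qinv_asc_expand[OF assms(2-4) z] by (simp add: sum_distrib_left mult.assoc)
    also have "\<dots> = (\<Sum>j\<le>n. f j * asc_basis q b j z)"
      unfolding f_def sum_distrib_right by (rule sum.swap)
    finally show "qinv_al_salam_chihara n z a b q = (\<Sum>j\<le>n. f j * asc_basis q b j z)" .
  qed
qed

lemma has_sum_sum:
  fixes f :: "'i \<Rightarrow> 'k \<Rightarrow> 'a :: topological_comm_monoid_add"
  assumes "\<And>i. i \<in> I \<Longrightarrow> (f i has_sum S i) A"
  shows "((\<lambda>k. \<Sum>i\<in>I. f i k) has_sum (\<Sum>i\<in>I. S i)) A"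
  using assms by (induction I rule: infinite_finite_induct) (auto intro!: has_sum_add)

context
  fixes q \<alpha> a b :: complex
  assumes q: "norm q < 1" "q \<noteq> 0" and nz: "\<alpha> \<noteq> 0" "a \<noteq> 0" "b \<noteq> 0"
begin

text \<open>
  The factors \<open>\<phi>\<^sub>i(a)\<close> and \<open>\<phi>\<^sub>j(b)\<close> turn the sum into the total mass with the parameters \<open>a q\<^sup>-\<^sup>i\<close>
  and \<open>b q\<^sup>-\<^sup>j\<close>.  This depends on them only through \<open>(- a b q\<^bsup>1 - i - j\<^esup>;q)\<^sub>\<infinity>\<close>, which explains the
  symbol \<open>(- 1 / (a b);q)\<^bsub>i + j\<^esub>\<close>.
\<close>

lemma moment_asc_basis:
  "((\<lambda>k. asc_basis q a i (q powi k * \<alpha>) * asc_basis q b j (q powi k * \<alpha>) * mass_term q \<alpha> a b k) has_sum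
     (mass q \<alpha> a b * (- 1) ^ (i + j) * (b / a) ^ i * (a / b) ^ j
       * q powi binom2 (int i) * q powi binom2 (int j) / q ^ (i * j) * qpoch (- 1 / (a * b)) q (i + j))) UNIV"
    (is "(_ has_sum ?S) _")
proof -
  define K where "K c l = (- 1) ^ l * (q powi binom2 (int l))\<^sup>2 / c ^ (2 * l)" for c l
  have "asc_basis q a i (q powi k * \<alpha>) * asc_basis q b j (q powi k * \<alpha>) * mass_term q \<alpha> a b k
      = K a i * K b j * mass_term q \<alpha> (a / q ^ i) (b / q ^ j) k" for k
  proof -
    have "asc_basis q a i (q powi k * \<alpha>) * asc_basis q b j (q powi k * \<alpha>) * mass_term q \<alpha> a b k
        = (1 + (q powi k * \<alpha>)\<^sup>2) * theta_weight q \<alpha> k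
          * ((asc_basis q a i (q powi k * \<alpha>) * hermite_gen q a (q powi k * \<alpha>))
           * (asc_basis q b j (q powi k * \<alpha>) * hermite_gen q b (q powi k * \<alpha>)))"
      by (simp only: mass_term_def mult_ac)
    also have "\<dots> = K a i * K b j * mass_term q \<alpha> (a / q ^ i) (b / q ^ j) k"
      unfolding asc_basis_hermite_gen[OF q nz(2) z_nonzero[OF q nz(1)]]
        asc_basis_hermite_gen[OF q nz(3) z_nonzero[OF q nz(1)]] K_def[symmetric]
      by (simp only: mass_term_def mult_ac)
    finally show ?thesis .
  qed
  moreover have "K a i * K b j * mass q \<alpha> (a / q ^ i) (b / q ^ j) = ?S"
  proof -
    have regroup: "A * (M * (B * C)) = M * (A * B) * C" for A B C M :: complex
      by (simp only: mult_ac)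
    have "- q * (a / q ^ i) * (b / q ^ j) = - q * (a * b) / q ^ (i + j)"
      by (simp add: power_add)
    then have 1: "mass q \<alpha> (a / q ^ i) (b / q ^ j)
        = mass q \<alpha> a b * ((a * b) ^ (i + j) / q powi binom2 (int (i + j)) * qpoch (- 1 / (a * b)) q (i + j))"
      unfolding mass_eq[OF q nz(1)]
      using qpoch_inf_shift_down[OF q, of "a * b" "i + j"] nz by (simp only:) (simp add: mult_ac)
    have 2: "K a i * K b j * ((a * b) ^ (i + j) / q powi binom2 (int (i + j)))
        = (- 1) ^ (i + j) * (b / a) ^ i * (a / b) ^ j
       * q powi binom2 (int i) * q powi binom2 (int j) / q ^ (i * j)"
      unfolding powi_binom2_add[OF q(2)] K_def using q nz
      by (simp add: power_mult_distrib power_divide power_add power_mult power2_eq_square mult_ac)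
    show ?thesis
      by (subst 1, subst regroup, subst 2) simp
  qed
  ultimately show ?thesis
    using has_sum_cmult_right[OF mass_term_has_sum[OF q nz(1)], of "K a i * K b j" "a / q ^ i" "b / q ^ j"]
    by simp
qed

text \<open>
  With \<open>c = - 1 / (a b)\<close>, the factor \<open>(c q\<^sup>i;q)\<^bsub>n - i\<^esub>\<close> of the coefficient and \<open>(c;q)\<^bsub>i + j\<^esub>\<close> of the
  moment combine to \<open>(c;q)\<^sub>n (c q\<^sup>i;q)\<^sub>j\<close>.  What remains is the terminating series
  \<open>qbinom_sum q n c j\<close> at \<open>q\<^bsup>n - j\<^esup>\<close>.
\<close>

lemma moment_asc_poly:
  assumes "j \<le> n"
  shows "((\<lambda>k. qinv_al_salam_chihara n (q powi k * \<alpha>) a b q * asc_basis q b j (q powi k * \<alpha>)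
             * mass_term q \<alpha> a b k) has_sum
     (if j = n then mass q \<alpha> a b * (- a) ^ n * (qpoch q q n * qpoch (- 1 / (a * b)) q n)
                      / (q powi binom2 (int n) * q ^ n) else 0)) UNIV"
    (is "(_ has_sum ?S) _")
proof -
  define c where "c = - 1 / (a * b)"
  define L where "L i = mass q \<alpha> a b * (- 1) ^ (i + j) * (b / a) ^ i * (a / b) ^ j
       * q powi binom2 (int i) * q powi binom2 (int j) / q ^ (i * j) * qpoch c q (i + j)" for i
  have "((\<lambda>k. \<Sum>i\<le>n. asc_coeff q a b n i * (asc_basis q a i (q powi k * \<alpha>) * asc_basis q b j (q powi k * \<alpha>)
             * mass_term q \<alpha> a b k)) has_sum (\<Sum>i\<le>n. asc_coeff q a b n i * L i)) UNIV"
    unfolding L_def c_def by (intro has_sum_sum has_sum_cmult_right moment_asc_basis)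
  moreover have "(\<Sum>i\<le>n. asc_coeff q a b n i * L i) = ?S"
  proof -
    define C where "C = (- b) ^ n / q powi binom2 (int n) * mass q \<alpha> a b * (- 1) ^ j * (a / b) ^ j
      * q powi binom2 (int j) * qpoch c q n"
    have "asc_coeff q a b n i * L i
        = C * (qpoch (q powi (- int n)) q i / qpoch q q i * (q ^ (n - j)) ^ i * qpoch (c * q ^ i) q j)"
      if "i \<le> n" for i
    proof -
      have 1: "qpoch c q n = qpoch c q i * qpoch (c * q ^ i) q (n - i)"
        using qpoch_add[of c q i "n - i"] that by simp
      have 2: "qpoch c q (i + j) = qpoch c q i * qpoch (c * q ^ i) q j"
        by (rule qpoch_add)
      have 3: "(q ^ (n - j)) ^ i = q ^ (n * i) / q ^ (i * j)"
        using assms q(2) by (simp add: power_diff power_divide mult.commute flip: power_mult)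
      have 4: "(q ^ n * a / b) ^ i * (b / a) ^ i = q ^ (n * i)"
        using nz by (simp add: power_mult flip: power_mult_distrib)
      have 5: "(- 1) ^ i * (- 1) ^ (i + j) = ((- 1) ^ j :: complex)"
        by (simp add: power_add flip: power_mult_distrib mult.assoc)
      have "asc_coeff q a b n i * L i = (- b) ^ n / q powi binom2 (int n) * mass q \<alpha> a b
          * ((- 1) ^ i * (- 1) ^ (i + j)) * (a / b) ^ j * q powi binom2 (int j)
          * (qpoch (q powi (- int n)) q i / qpoch q q i)
          * ((q ^ n * a / b) ^ i * (b / a) ^ i) / q ^ (i * j)
          * (qpoch (c * q ^ i) q (n - i) * qpoch c q (i + j))"
        using q(2) by (simp add: asc_coeff_def L_def c_def)
      then show ?thesis
        unfolding 4 5 2 C_def 1 3 by (simp add: mult_ac)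
    qed
    then have "(\<Sum>i\<le>n. asc_coeff q a b n i * L i) = C * qbinom_sum q n c j (q ^ (n - j))"
      by (simp add: qbinom_sum_def sum_distrib_left)
    also have "\<dots> = ?S"
    proof (cases "j = n")
      case True
      have "(- b) ^ n * (- 1) ^ n * (a / b) ^ n * (- 1) ^ n = (- a) ^ n"
        using nz by (simp flip: power_mult_distrib)
      then have "C * qpoch (q powi (- int n)) q n = ?S"
        unfolding C_def qpoch_powi_neg[OF q(2)] using q(2) True
        by (simp add: c_def) (simp add: mult_ac)
      then show ?thesis
        using True qbinom_sum_1[OF q, of n n c] by simp
    next
      case False
      then show ?thesis
        using assms qbinom_sum_eq_0[OF q, of "n - j" j n c] by simp
    qed
    finally show ?thesis .
  qed
  moreover have "(\<Sum>i\<le>n. asc_coeff q a b n i * (asc_basis q a i (q powi k * \<alpha>) * asc_basis q b j (q powi k * \<alpha>)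
             * mass_term q \<alpha> a b k))
      = qinv_al_salam_chihara n (q powi k * \<alpha>) a b q * asc_basis q b j (q powi k * \<alpha>) * mass_term q \<alpha> a b k" for k
    unfolding qinv_asc_expand[OF q(2) nz(2,3) z_nonzero[OF q nz(1)]] sum_distrib_right
    by (simp only: mult.assoc)
  ultimately show ?thesis by simp
qed

lemma orthogonality_le:
  assumes "m \<le> n"
  shows "((\<lambda>k. qinv_al_salam_chihara m (q powi k * \<alpha>) a b q * qinv_al_salam_chihara n (q powi k * \<alpha>) a b q
             * mass_term q \<alpha> a b k) has_sum
     (if m = n then mass q \<alpha> a b * (a * b) ^ n * (qpoch q q n * qpoch (- 1 / (a * b)) q n)
                      / ((q powi binom2 (int n))\<^sup>2 * q ^ n) else 0)) UNIV"
    (is "(_ has_sum ?S) _")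
proof -
  obtain f where f: "f m = (- b) ^ m / q powi binom2 (int m)"
    "\<And>z. z \<noteq> 0 \<Longrightarrow> qinv_al_salam_chihara m z a b q = (\<Sum>j\<le>m. f j * asc_basis q b j z)"
    using qinv_asc_expand_swapped[OF q nz(2,3), of m] by blast
  define T where "T j = (if j = n then mass q \<alpha> a b * (- a) ^ n * (qpoch q q n * qpoch (- 1 / (a * b)) q n)
                      / (q powi binom2 (int n) * q ^ n) else 0)" for j
  have "((\<lambda>k. \<Sum>j\<le>m. f j * (qinv_al_salam_chihara n (q powi k * \<alpha>) a b q * asc_basis q b j (q powi k * \<alpha>)
             * mass_term q \<alpha> a b k)) has_sum (\<Sum>j\<le>m. f j * T j)) UNIV"
    unfolding T_def by (intro has_sum_sum has_sum_cmult_right moment_asc_poly) (use assms in auto)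
  moreover have "(\<Sum>j\<le>m. f j * (qinv_al_salam_chihara n (q powi k * \<alpha>) a b q * asc_basis q b j (q powi k * \<alpha>)
             * mass_term q \<alpha> a b k))
      = qinv_al_salam_chihara m (q powi k * \<alpha>) a b q * qinv_al_salam_chihara n (q powi k * \<alpha>) a b q
             * mass_term q \<alpha> a b k" for k
    unfolding f(2)[OF z_nonzero[OF q nz(1)]] sum_distrib_right by (simp only: mult_ac)
  moreover have "(\<Sum>j\<le>m. f j * T j) = ?S"
  proof (cases "m = n")
    case True
    have "(\<Sum>j\<le>m. f j * T j) = (\<Sum>j\<in>{n}. f j * T j)"
      using True by (intro sum.mono_neutral_right) (auto simp: T_def)
    also have "\<dots> = ?S"
    proof -
      have "(- b) ^ n * (- a) ^ n = (a * b) ^ n" by (simp add: mult.commute flip: power_mult_distrib)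
      then show ?thesis
        using True f(1) by (simp add: T_def power2_eq_square) (simp add: mult_ac)
    qed
    finally show ?thesis .
  next
    case False
    then show ?thesis using assms by (simp add: T_def)
  qed
  ultimately show ?thesis by simp
qed

lemma orthogonality:
  "((\<lambda>k. qinv_al_salam_chihara m (q powi k * \<alpha>) a b q * qinv_al_salam_chihara n (q powi k * \<alpha>) a b q
             * mass_term q \<alpha> a b k) has_sum
     (if m = n then mass q \<alpha> a b * (a * b) ^ n * (qpoch q q n * qpoch (- 1 / (a * b)) q n)
                      / ((q powi binom2 (int n))\<^sup>2 * q ^ n) else 0)) UNIV"
proof (cases "m \<le> n")
  case True
  then show ?thesis by (rule orthogonality_le)
next
  case False
  then show ?thesis
    using orthogonality_le[of n m] by (simp add: mult.commute mult.left_commute)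
qed

end

theorem theorem3p4:
  fixes m n :: nat and q \<alpha> a b :: complex
  assumes "0 < norm q" "norm q < 1"
    and "\<alpha> \<noteq> 0" "a \<noteq> 0" "b \<noteq> 0"
    and "\<forall>t\<in>{a, b}. qpoch_inf (- q * \<alpha> * t) q \<noteq> 0 \<and> qpoch_inf (q * t / \<alpha>) q \<noteq> 0"
  shows "((\<lambda>k::int.
            (1 + q powi (2 * k) * \<alpha>\<^sup>2)
            * qinv_al_salam_chihara m (q powi k * \<alpha>) a b q
            * qinv_al_salam_chihara n (q powi k * \<alpha>) a b q
            * (qpoch_int (\<alpha> / a) q k * qpoch_int (\<alpha> / b) q k)
            / (qpoch_int (- q * \<alpha> * a) q k * qpoch_int (- q * \<alpha> * b) q k)
            * q powi (2 * binom2 k) * (q * \<alpha>\<^sup>2 * a * b) powi k)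
          has_sum
            (qpoch_inf q q * qpoch_inf (- \<alpha>\<^sup>2) q * qpoch_inf (- q / \<alpha>\<^sup>2) q * qpoch_inf (- q * a * b) q
             / (qpoch_inf (- q * \<alpha> * a) q * qpoch_inf (- q * \<alpha> * b) q
                * qpoch_inf (q * a / \<alpha>) q * qpoch_inf (q * b / \<alpha>) q)
             * q powi (- 2 * binom2 (int n)) * (a * b / q) ^ n
             * (qpoch q q n * qpoch (- 1 / (a * b)) q n)
             * (if m = n then 1 else 0))) UNIV"
proof -
  have q: "norm q < 1" "q \<noteq> 0" using assms(1,2) by auto
  define P where "P = qpoch_inf (- q * \<alpha> * a) q * qpoch_inf (- q * \<alpha> * b) q
                * qpoch_inf (q * a / \<alpha>) q * qpoch_inf (q * b / \<alpha>) q"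
  define Q where "Q j k = qinv_al_salam_chihara j (q powi k * \<alpha>) a b q" for j k
  define w where "w k = (1 + q powi (2 * k) * \<alpha>\<^sup>2) * (qpoch_int (\<alpha> / a) q k * qpoch_int (\<alpha> / b) q k)
            / (qpoch_int (- q * \<alpha> * a) q k * qpoch_int (- q * \<alpha> * b) q k)
            * q powi (2 * binom2 k) * (q * \<alpha>\<^sup>2 * a * b) powi k" for k
  have w: "w k = mass_term q \<alpha> a b k / P" for k
    unfolding w_def P_def using assms by (intro weight_eq_mass_term q) auto
  have e: "q powi (- 2 * binom2 (int n)) = 1 / (q powi binom2 (int n))\<^sup>2"
  proof -
    have "- 2 * binom2 (int n) = - (binom2 (int n) + binom2 (int n))" by simp
    then show ?thesis
      using q(2) by (simp only: power_int_minus power_int_add power2_eq_square simp_thms) (simp add: divide_inverse)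
  qed
  have "((\<lambda>k. 1 / P * (Q m k * Q n k * mass_term q \<alpha> a b k)) has_sum
     (1 / P * (if m = n then mass q \<alpha> a b * (a * b) ^ n * (qpoch q q n * qpoch (- 1 / (a * b)) q n)
                      / ((q powi binom2 (int n))\<^sup>2 * q ^ n) else 0))) UNIV"
    unfolding Q_def by (intro has_sum_cmult_right orthogonality q assms)
  moreover have "1 / P * (Q m k * Q n k * mass_term q \<alpha> a b k)
      = (1 + q powi (2 * k) * \<alpha>\<^sup>2) * Q m k * Q n k * (qpoch_int (\<alpha> / a) q k * qpoch_int (\<alpha> / b) q k)
            / (qpoch_int (- q * \<alpha> * a) q k * qpoch_int (- q * \<alpha> * b) q k)
            * q powi (2 * binom2 k) * (q * \<alpha>\<^sup>2 * a * b) powi k" for k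
  proof -
    have "1 / P * (Q m k * Q n k * mass_term q \<alpha> a b k) = Q m k * Q n k * w k"
      by (simp add: w)
    then show ?thesis
      unfolding w_def by (simp add: divide_inverse mult_ac)
  qed
  moreover have "1 / P * (if m = n then mass q \<alpha> a b * (a * b) ^ n * (qpoch q q n * qpoch (- 1 / (a * b)) q n)
                      / ((q powi binom2 (int n))\<^sup>2 * q ^ n) else 0)
      = qpoch_inf q q * qpoch_inf (- \<alpha>\<^sup>2) q * qpoch_inf (- q / \<alpha>\<^sup>2) q * qpoch_inf (- q * a * b) q / P
             * q powi (- 2 * binom2 (int n)) * (a * b / q) ^ n
             * (qpoch q q n * qpoch (- 1 / (a * b)) q n) * (if m = n then 1 else 0)"
    unfolding e mass_eq[OF q assms(3), symmetric] by (simp add: power_divide)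
  ultimately show ?thesis
    unfolding Q_def P_def by (simp only:)
qed

end
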